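(* Let $A$ be a quasinormed operator ideal and let $X$ be a Banach space for which the set of finite rank operators is dense in the space $A(X)$. Suppose that the standard functional $u\mapsto\det(1+u)$ admits a continuous extension (with respect to the quasinorm of $A(X)$) from the subspace of all finite rank operators of $A(X)$ to all of $A(X)$. Then the functional $\operatorname{trace}$ is bounded (with respect to the $A$-quasinorm) on the subspace of all finite rank operators of $A(X)$ and hence extends by continuity, in a unique way, to all of $A(X)$.
   Context: Banach spaces are complex. An operator ideal $A$ is a class of bounded operators with components $A(X,Y)\subset L(X,Y)$ such that the identity $1_K$ of the one-dimensional space $K$ is in $A$, each $A(X,Y)$ is a linear subspace, and $TUS\in A(Z,W)$ for $S\in L(Z,X)$, $U\in A(X,Y)$, $T\in L(Y,W)$. It is quasinormed if it carries a function $\|\cdot\|_A$ that is a quasinorm on each component (positive definite, homogeneous, with $\|U+V\|_A\le C(\|U\|_A+\|V\|_A)$ for some constant $C$), with $\|1_K\|_A=1$ and $\|TUS\|_A\le\|T\|\,\|U\|_A\,\|S\|$. Write $A(X)=A(X,X)$. For a finite rank operator $u=\sum_{k=1}^N x_k'\otimes x_k$ on $X$, $\operatorname{trace}u=\sum_{k=1}^N x_k'(x_k)$ and $\det(1+u)=\prod_j(1+\mu_j)$, where $(\mu_j)$ is the complete system of eigenvalues of $u$, counted with multiplicity. Boundedness of the trace means $|\operatorname{trace}u|\le b\|u\|_A$ for some constant $b$ and all finite rank $u\in A(X)$. *)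

theory Defs
  imports "HOL-Analysis.Analysis" "Jordan_Normal_Form.VS_Connect"
begin

section \<open>Complex Banach spaces with an explicit carrier\<close>

text \<open>
  An operator ideal is indexed by all Banach spaces, so Banach spaces have to be values rather than
  types. They are carrier-based structures whose carriers are subsets of a type \<open>'a\<close>; this type
  plays the role of the universe and is arbitrary. The ring fields \<open>mult\<close> and \<open>one\<close> of the module
  record are not used.
\<close>

record 'a nspace = "(complex, 'a) module" +
  nrm :: "'a \<Rightarrow> real"

text \<open>The guard only serves to meet the global axioms of \<^locale>\<open>Metric_space\<close>.\<close>

definition norm_dist :: "'a nspace \<Rightarrow> 'a \<Rightarrow> 'a \<Rightarrow> real" where
  "norm_dist X x y =
    (if x \<in> carrier X \<and> y \<in> carrier X then nrm X (x \<ominus>\<^bsub>X\<^esub> y) else 0)"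

locale complex_banach_space = vectorspace "class_ring :: complex ring" X
  for X :: "'a nspace" +
  assumes nrm_nonneg: "x \<in> carrier X \<Longrightarrow> 0 \<le> nrm X x"
    and nrm_eq_zero_iff: "x \<in> carrier X \<Longrightarrow> nrm X x = 0 \<longleftrightarrow> x = \<zero>\<^bsub>X\<^esub>"
    and nrm_smult: "x \<in> carrier X \<Longrightarrow> nrm X (c \<odot>\<^bsub>X\<^esub> x) = cmod c * nrm X x"
    and nrm_triangle:
      "x \<in> carrier X \<Longrightarrow> y \<in> carrier X \<Longrightarrow> nrm X (x \<oplus>\<^bsub>X\<^esub> y) \<le> nrm X x + nrm X y"
    and complete: "Metric_space.mcomplete (carrier X) (norm_dist X)"

definition scalar_space :: "complex nspace" where
  "scalar_space = \<lparr>carrier = UNIV, mult = (*), one = 1, zero = 0, add = (+), smult = (*), nrm = cmod\<rparr>"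

definition one_dimensional :: "'a nspace \<Rightarrow> bool" where
  "one_dimensional K \<longleftrightarrow>
    vectorspace.fin_dim (class_ring :: complex ring) K \<and>
    vectorspace.dim (class_ring :: complex ring) K = 1"


section \<open>Bounded operators\<close>

text \<open>
  Operators are extensional functions (\<open>undefined\<close> off the carrier), so that equality of operators
  is equality in HOL.
\<close>

definition bounded_ops :: "'a nspace \<Rightarrow> 'b nspace \<Rightarrow> ('a \<Rightarrow> 'b) set" where
  "bounded_ops X Y =
    {u \<in> module_hom (class_ring :: complex ring) X Y \<inter> extensional (carrier X).
      \<exists>c. \<forall>x\<in>carrier X. nrm Y (u x) \<le> c * nrm X x}"

text \<open>As for \<^const>\<open>onorm\<close>, the convention \<open>0 / 0 = 0\<close> handles the zero vector.\<close>

definition op_norm :: "'a nspace \<Rightarrow> 'b nspace \<Rightarrow> ('a \<Rightarrow> 'b) \<Rightarrow> real" where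
  "op_norm X Y u = (SUP x\<in>carrier X. nrm Y (u x) / nrm X x)"

definition op_id :: "'a nspace \<Rightarrow> 'a \<Rightarrow> 'a" where
  "op_id X = (\<lambda>x\<in>carrier X. x)"

definition op_zero :: "'a nspace \<Rightarrow> 'b nspace \<Rightarrow> 'a \<Rightarrow> 'b" where
  "op_zero X Y = (\<lambda>x\<in>carrier X. \<zero>\<^bsub>Y\<^esub>)"

definition op_add :: "'a nspace \<Rightarrow> 'b nspace \<Rightarrow> ('a \<Rightarrow> 'b) \<Rightarrow> ('a \<Rightarrow> 'b) \<Rightarrow> 'a \<Rightarrow> 'b" where
  "op_add X Y u v = (\<lambda>x\<in>carrier X. u x \<oplus>\<^bsub>Y\<^esub> v x)"

definition op_diff :: "'a nspace \<Rightarrow> 'b nspace \<Rightarrow> ('a \<Rightarrow> 'b) \<Rightarrow> ('a \<Rightarrow> 'b) \<Rightarrow> 'a \<Rightarrow> 'b" where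
  "op_diff X Y u v = (\<lambda>x\<in>carrier X. u x \<ominus>\<^bsub>Y\<^esub> v x)"

definition op_scale :: "'a nspace \<Rightarrow> 'b nspace \<Rightarrow> complex \<Rightarrow> ('a \<Rightarrow> 'b) \<Rightarrow> 'a \<Rightarrow> 'b" where
  "op_scale X Y c u = (\<lambda>x\<in>carrier X. c \<odot>\<^bsub>Y\<^esub> u x)"


section \<open>Finite rank operators, trace and determinant\<close>

definition dual :: "'a nspace \<Rightarrow> ('a \<Rightarrow> complex) set" where
  "dual X = bounded_ops X scalar_space"

definition finite_rank_rep ::
    "'a nspace \<Rightarrow> nat \<Rightarrow> (nat \<Rightarrow> 'a \<Rightarrow> complex) \<Rightarrow> (nat \<Rightarrow> 'a) \<Rightarrow> ('a \<Rightarrow> 'a) \<Rightarrow> bool" where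
  "finite_rank_rep X N f x u \<longleftrightarrow>
    (\<forall>k<N. f k \<in> dual X \<and> x k \<in> carrier X) \<and>
    u = (\<lambda>y\<in>carrier X. \<Oplus>\<^bsub>X\<^esub>k\<in>{..<N}. f k y \<odot>\<^bsub>X\<^esub> x k)"

definition finite_rank_ops :: "'a nspace \<Rightarrow> ('a \<Rightarrow> 'a) set" where
  "finite_rank_ops X = {u. \<exists>N f x. finite_rank_rep X N f x u}"

definition op_trace :: "'a nspace \<Rightarrow> ('a \<Rightarrow> 'a) \<Rightarrow> complex" where
  "op_trace X u = (THE t. \<exists>N f x. finite_rank_rep X N f x u \<and> t = (\<Sum>k<N. f k (x k)))"

definition eigenvalues :: "'a nspace \<Rightarrow> ('a \<Rightarrow> 'a) \<Rightarrow> complex set" where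
  "eigenvalues X u = {\<mu>. \<exists>x\<in>carrier X. x \<noteq> \<zero>\<^bsub>X\<^esub> \<and> u x = \<mu> \<odot>\<^bsub>X\<^esub> x}"

definition generalized_eigenspace :: "'a nspace \<Rightarrow> ('a \<Rightarrow> 'a) \<Rightarrow> complex \<Rightarrow> 'a set" where
  "generalized_eigenspace X u \<mu> =
    {x \<in> carrier X. \<exists>n. ((\<lambda>y. u y \<ominus>\<^bsub>X\<^esub> \<mu> \<odot>\<^bsub>X\<^esub> y) ^^ n) x = \<zero>\<^bsub>X\<^esub>}"

definition alg_mult :: "'a nspace \<Rightarrow> ('a \<Rightarrow> 'a) \<Rightarrow> complex \<Rightarrow> nat" where
  "alg_mult X u \<mu> =
    vectorspace.dim (class_ring :: complex ring) (X\<lparr>carrier := generalized_eigenspace X u \<mu>\<rparr>)"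

text \<open>
  This is \<open>det (1 + u)\<close> for a finite rank operator \<open>u\<close>. The eigenvalue \<open>0\<close> may have infinite
  multiplicity (where \<^const>\<open>vectorspace.dim\<close> is unspecified), but it contributes the factor \<open>1\<close>
  in any case.
\<close>

definition det_one_plus :: "'a nspace \<Rightarrow> ('a \<Rightarrow> 'a) \<Rightarrow> complex" where
  "det_one_plus X u = (\<Prod>\<mu>\<in>eigenvalues X u. (1 + \<mu>) ^ alg_mult X u \<mu>)"


section \<open>Quasinormed operator ideals\<close>

text \<open>
  The universe \<open>'a\<close> need not contain the field of scalars itself, so \<open>K\<close> ranges over its
  one-dimensional Banach spaces. They are all isometrically isomorphic to the scalars, and every
  nonzero Banach space over \<open>'a\<close> has one of them as a subspace.
\<close>

locale operator_ideal =
  fixes A :: "'a nspace \<Rightarrow> 'a nspace \<Rightarrow> ('a \<Rightarrow> 'a) set"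
  assumes bounded:
      "complex_banach_space X \<Longrightarrow> complex_banach_space Y \<Longrightarrow> A X Y \<subseteq> bounded_ops X Y"
    and id_one_dim: "complex_banach_space K \<Longrightarrow> one_dimensional K \<Longrightarrow> op_id K \<in> A K K"
    and zero_mem:
      "complex_banach_space X \<Longrightarrow> complex_banach_space Y \<Longrightarrow> op_zero X Y \<in> A X Y"
    and add_mem:
      "complex_banach_space X \<Longrightarrow> complex_banach_space Y \<Longrightarrow>
        u \<in> A X Y \<Longrightarrow> v \<in> A X Y \<Longrightarrow> op_add X Y u v \<in> A X Y"
    and scale_mem:
      "complex_banach_space X \<Longrightarrow> complex_banach_space Y \<Longrightarrow>
        u \<in> A X Y \<Longrightarrow> op_scale X Y c u \<in> A X Y"
    and compose_mem:
      "complex_banach_space Z \<Longrightarrow> complex_banach_space X \<Longrightarrow>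
       complex_banach_space Y \<Longrightarrow> complex_banach_space W \<Longrightarrow>
        s \<in> bounded_ops Z X \<Longrightarrow> u \<in> A X Y \<Longrightarrow> t \<in> bounded_ops Y W \<Longrightarrow>
        compose (carrier Z) t (compose (carrier Z) u s) \<in> A Z W"

text \<open>The constant in the quasi-triangle inequality may depend on the component.\<close>

locale quasinormed_operator_ideal = operator_ideal A
  for A :: "'a nspace \<Rightarrow> 'a nspace \<Rightarrow> ('a \<Rightarrow> 'a) set" +
  fixes q :: "'a nspace \<Rightarrow> 'a nspace \<Rightarrow> ('a \<Rightarrow> 'a) \<Rightarrow> real"
  assumes q_nonneg:
      "complex_banach_space X \<Longrightarrow> complex_banach_space Y \<Longrightarrow> u \<in> A X Y \<Longrightarrow> 0 \<le> q X Y u"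
    and q_eq_zero_iff:
      "complex_banach_space X \<Longrightarrow> complex_banach_space Y \<Longrightarrow> u \<in> A X Y \<Longrightarrow>
        q X Y u = 0 \<longleftrightarrow> u = op_zero X Y"
    and q_scale:
      "complex_banach_space X \<Longrightarrow> complex_banach_space Y \<Longrightarrow> u \<in> A X Y \<Longrightarrow>
        q X Y (op_scale X Y c u) = cmod c * q X Y u"
    and q_quasi_triangle:
      "complex_banach_space X \<Longrightarrow> complex_banach_space Y \<Longrightarrow>
        \<exists>C. \<forall>u\<in>A X Y. \<forall>v\<in>A X Y. q X Y (op_add X Y u v) \<le> C * (q X Y u + q X Y v)"
    and q_id_one_dim:
      "complex_banach_space K \<Longrightarrow> one_dimensional K \<Longrightarrow> q K K (op_id K) = 1"
    and q_compose:
      "complex_banach_space Z \<Longrightarrow> complex_banach_space X \<Longrightarrow>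
       complex_banach_space Y \<Longrightarrow> complex_banach_space W \<Longrightarrow>
        s \<in> bounded_ops Z X \<Longrightarrow> u \<in> A X Y \<Longrightarrow> t \<in> bounded_ops Y W \<Longrightarrow>
        q Z W (compose (carrier Z) t (compose (carrier Z) u s))
          \<le> op_norm Y W t * q X Y u * op_norm Z X s"

text \<open>
  The topology of a component \<open>A X Y\<close> given by its quasinorm: balls form neighbourhood bases,
  although they need not be open.
\<close>

definition quasinorm_topology ::
    "('a nspace \<Rightarrow> 'a nspace \<Rightarrow> ('a \<Rightarrow> 'a) set) \<Rightarrow>
     ('a nspace \<Rightarrow> 'a nspace \<Rightarrow> ('a \<Rightarrow> 'a) \<Rightarrow> real) \<Rightarrow>
     'a nspace \<Rightarrow> 'a nspace \<Rightarrow> ('a \<Rightarrow> 'a) topology" where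
  "quasinorm_topology A q X Y =
    topology (\<lambda>U. U \<subseteq> A X Y \<and>
      (\<forall>u\<in>U. \<exists>e>0. \<forall>v\<in>A X Y. q X Y (op_diff X Y v u) < e \<longrightarrow> v \<in> U))"

lemma openin_quasinorm_topology:
  "openin (quasinorm_topology A q X Y) U \<longleftrightarrow>
    U \<subseteq> A X Y \<and> (\<forall>u\<in>U. \<exists>e>0. \<forall>v\<in>A X Y. q X Y (op_diff X Y v u) < e \<longrightarrow> v \<in> U)"
proof -
  let ?P = "\<lambda>U. U \<subseteq> A X Y \<and> (\<forall>u\<in>U. \<exists>e>0. \<forall>v\<in>A X Y. q X Y (op_diff X Y v u) < e \<longrightarrow> v \<in> U)"
  have "?P (S \<inter> T)" if S: "?P S" and T: "?P T" for S T
  proof (intro conjI ballI)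
    show "S \<inter> T \<subseteq> A X Y" using S by blast
    fix u assume u: "u \<in> S \<inter> T"
    obtain d where d: "d > 0" "\<forall>v\<in>A X Y. q X Y (op_diff X Y v u) < d \<longrightarrow> v \<in> S"
      using S u by blast
    obtain e where e: "e > 0" "\<forall>v\<in>A X Y. q X Y (op_diff X Y v u) < e \<longrightarrow> v \<in> T"
      using T u by blast
    show "\<exists>e>0. \<forall>v\<in>A X Y. q X Y (op_diff X Y v u) < e \<longrightarrow> v \<in> S \<inter> T"
      using d e by (intro exI[of _ "min d e"]) auto
  qed
  moreover have "?P (\<Union>\<K>)" if "\<forall>K\<in>\<K>. ?P K" for \<K>
  proof (intro conjI ballI)
    show "\<Union>\<K> \<subseteq> A X Y" using that by blast
    fix u assume "u \<in> \<Union>\<K>"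
    then obtain K where K: "K \<in> \<K>" "u \<in> K" by blast
    then obtain e where "e > 0" "\<forall>v\<in>A X Y. q X Y (op_diff X Y v u) < e \<longrightarrow> v \<in> K"
      using \<open>\<forall>K\<in>\<K>. ?P K\<close> by blast
    then show "\<exists>e>0. \<forall>v\<in>A X Y. q X Y (op_diff X Y v u) < e \<longrightarrow> v \<in> \<Union>\<K>"
      using K by blast
  qed
  ultimately have "istopology ?P"
    unfolding istopology_def by blast
  then show ?thesis
    by (simp add: quasinorm_topology_def topology_inverse')
qed

definition extends_continuously ::
    "('a nspace \<Rightarrow> 'a nspace \<Rightarrow> ('a \<Rightarrow> 'a) set) \<Rightarrow>
     ('a nspace \<Rightarrow> 'a nspace \<Rightarrow> ('a \<Rightarrow> 'a) \<Rightarrow> real) \<Rightarrow>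
     'a nspace \<Rightarrow> (('a \<Rightarrow> 'a) \<Rightarrow> complex) \<Rightarrow> (('a \<Rightarrow> 'a) \<Rightarrow> complex) \<Rightarrow> bool" where
  "extends_continuously A q X \<phi> \<Phi> \<longleftrightarrow>
    continuous_map (quasinorm_topology A q X X) euclidean \<Phi> \<and>
    (\<forall>u \<in> A X X \<inter> finite_rank_ops X. \<Phi> u = \<phi> u)"

end

theory Submission
  imports Defs "Jordan_Normal_Form.Jordan_Normal_Form_Existence"
    "Jordan_Normal_Form.Jordan_Normal_Form_Uniqueness"
    "HOL-Complex_Analysis.Cauchy_Integral_Formula"
begin

text \<open>
  Let \<open>u\<close> be a finite rank operator with nonzero eigenvalues \<open>\<mu>\<^sub>1, \<dots>, \<mu>\<^sub>n\<close>, repeated according to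
  algebraic multiplicity. The function \<open>z \<mapsto> det (1 + z u) = \<Prod>\<^sub>j (1 + z \<mu>\<^sub>j)\<close> is a polynomial whose linear
  coefficient is \<open>\<Sum>\<^sub>j \<mu>\<^sub>j = trace u\<close>. If the determinant is continuous at \<open>0\<close>, there is \<open>\<delta> > 0\<close> such that
  \<open>det (1 + v)\<close> differs from \<open>1\<close> by at most \<open>1\<close> whenever the quasinorm of \<open>v\<close> is below \<open>\<delta>\<close>. If the
  quasinorm of \<open>u\<close> is below \<open>\<delta>\<close>, this applies to all \<open>z u\<close> with \<open>\<bar>z\<bar> \<le> 1\<close>, and Cauchy's inequality for
  the derivative at \<open>0\<close> gives \<open>\<bar>trace u\<bar> \<le> 1\<close> (\<open>linear_coefficient_bound\<close>). By homogeneity the trace is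
  bounded (\<open>op_trace_bounded\<close>). A bounded linear functional on a dense subspace has a unique
  continuous extension, and this extension is linear.

  The algebraic ingredient is that the trace defined by a representation is the sum of the
  eigenvalues (\<open>sum_eigenvalues_eq\<close>); in particular it does not depend on the representation. A
  representation \<open>u = \<Sum>\<^sub>k f\<^sub>k \<otimes> x\<^sub>k\<close> of length \<open>N\<close> is a factorization \<open>u = S T\<close> through \<open>\<complex>\<^sup>N\<close>, while \<open>M = T S\<close> is
  the matrix \<open>(f\<^sub>j(x\<^sub>k))\<close>. For \<open>\<mu> \<noteq> 0\<close> the map \<open>S\<close> is a bijection from the generalized eigenspace of
  \<open>M\<close> onto that of \<open>u\<close>, so that the multiplicities agree, and for \<open>M\<close> the claim follows from the Jordan
  normal form.
\<close>

section \<open>Trace and generalized eigenspaces of matrices\<close>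

lemma sum_list_diag_mat_mult_commute:
  fixes A B :: "'a :: comm_semiring_0 mat"
  assumes A: "A \<in> carrier_mat n m" and B: "B \<in> carrier_mat m n"
  shows "sum_list (diag_mat (A * B)) = sum_list (diag_mat (B * A))"
proof -
  have "sum_list (diag_mat (A * B)) = (\<Sum>i<n. \<Sum>j<m. A $$ (i, j) * B $$ (j, i))"
    using A B by (auto simp: diag_mat_def sum_list_distinct_conv_sum_set scalar_prod_def
        lessThan_atLeast0 intro!: sum.cong)
  also have "\<dots> = (\<Sum>j<m. \<Sum>i<n. B $$ (j, i) * A $$ (i, j))"
    by (subst sum.swap) (simp add: mult.commute)
  also have "\<dots> = sum_list (diag_mat (B * A))"
    using A B by (auto simp: diag_mat_def sum_list_distinct_conv_sum_set scalar_prod_def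
        lessThan_atLeast0 intro!: sum.cong)
  finally show ?thesis .
qed

lemma sum_list_diag_mat_similar:
  fixes A B :: "'a :: comm_ring_1 mat"
  assumes "similar_mat A B"
  shows "sum_list (diag_mat A) = sum_list (diag_mat B)"
proof -
  from assms obtain P Q where wit: "similar_mat_wit A B P Q"
    unfolding similar_mat_def by auto
  define n where "n = dim_row A"
  note d = similar_mat_witD[OF n_def wit]
  have "sum_list (diag_mat A) = sum_list (diag_mat ((P * B) * Q))"
    using d(3) by simp
  also have "\<dots> = sum_list (diag_mat (Q * (P * B)))"
    using d by (intro sum_list_diag_mat_mult_commute) auto
  also have "Q * (P * B) = B"
    using d(2) left_mult_one_mat[OF d(5)] by (simp flip: assoc_mult_mat[OF d(7) d(6) d(5)])
  finally show ?thesis .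
qed

lemma sum_list_diag_jordan_matrix:
  "sum_list (diag_mat (jordan_matrix n_as)) = (\<Sum>(k, a)\<leftarrow>n_as. of_nat k * (a :: 'a :: field))"
proof (induction n_as)
  case Nil
  then show ?case by (simp add: jordan_matrix_def diag_mat_def)
next
  case (Cons na n_as)
  obtain k a where na: "na = (k, a)" by force
  let ?m = "sum_list (map fst n_as)"
  have "jordan_matrix (na # n_as) =
      four_block_mat (jordan_block k a) (0\<^sub>m k ?m) (0\<^sub>m ?m k) (jordan_matrix n_as)"
    unfolding na jordan_matrix_def
    by (simp add: Let_def flip: jordan_matrix_def)
  moreover have "diag_mat (jordan_block k a) = replicate k a"
    using diag_jordan_block_pow[of k a 1] by simp
  ultimately show ?case
    using Cons.IH
    by (simp add: na diag_four_block_mat[of _ k _ ?m] sum_list_replicate carrier_matI)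
qed

lemma sum_list_map_eq_sum_group:
  fixes g :: "nat \<Rightarrow> 'b \<Rightarrow> 'a :: comm_monoid_add"
  assumes "finite E" "\<And>k a. (k, a) \<in> set xs \<Longrightarrow> a \<in> E \<or> g k a = 0"
  shows "(\<Sum>(k, a)\<leftarrow>xs. g k a) = (\<Sum>a\<in>E. \<Sum>k\<leftarrow>map fst [(k, e)\<leftarrow>xs. e = a]. g k a)"
  using assms(2)
proof (induction xs)
  case Nil
  then show ?case by simp
next
  case (Cons x xs)
  obtain k a where x: "x = (k, a)" by force
  have IH: "(\<Sum>(k, a)\<leftarrow>xs. g k a) = (\<Sum>a\<in>E. \<Sum>k\<leftarrow>map fst [(k, e)\<leftarrow>xs. e = a]. g k a)"
    using Cons by simp
  have "(\<Sum>b\<in>E. \<Sum>k\<leftarrow>map fst [(k, e)\<leftarrow>x # xs. e = b]. g k b) =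
      (\<Sum>b\<in>E. (if a = b then g k a else 0) + (\<Sum>k\<leftarrow>map fst [(k, e)\<leftarrow>xs. e = b]. g k b))"
    by (rule sum.cong) (auto simp: x)
  also have "\<dots> = g k a + (\<Sum>b\<in>E. \<Sum>k\<leftarrow>map fst [(k, e)\<leftarrow>xs. e = b]. g k b)"
    using Cons.prems[of k a] x by (auto simp: sum.distrib sum.delta' assms(1))
  finally show ?case
    by (simp add: x IH)
qed

text \<open>
  The summand \<open>j\<close> runs over the sizes of the Jordan blocks for \<open>\<mu>\<close>. No block is larger than \<open>n\<close>, which
  is why exponents \<open>k \<ge> n\<close> give the algebraic multiplicity.
\<close>

lemma dim_gen_eigenspace_stable:
  fixes M :: "'a :: field mat"
  assumes M: "M \<in> carrier_mat n n" and jnf: "jordan_nf M n_as" and k: "n \<le> k"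
  shows "dim_gen_eigenspace M \<mu> k = (\<Sum>j\<leftarrow>map fst [(j, e)\<leftarrow>n_as. e = \<mu>]. j)"
proof -
  have "similar_mat M (jordan_matrix n_as)"
    using jnf by (simp add: jordan_nf_def)
  then have n: "n = sum_list (map fst n_as)"
    using M similar_matD by fastforce
  have le: "fst p \<le> k" if "p \<in> set n_as" for p
    using member_le_sum_list[of "fst p" "map fst n_as"] that n k by force
  have "map (min k) (map fst [(j, e)\<leftarrow>n_as. e = \<mu>]) = map fst [(j, e)\<leftarrow>n_as. e = \<mu>]"
    using le by (intro map_idI) (fastforce simp: min_def)
  then show ?thesis
    by (simp only: dim_gen_eigenspace[OF jnf] list.map_ident)
qed

lemma complex_jordan_nf_exists:
  fixes M :: "complex mat"
  assumes "M \<in> carrier_mat n n"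
  obtains n_as where "jordan_nf M n_as"
  using char_poly_factorized[OF assms] jordan_nf_exists[OF assms] by blast

lemma sum_list_diag_mat_eq_sum_eigenvalues:
  fixes M :: "complex mat"
  assumes M: "M \<in> carrier_mat n n" and E: "finite E"
    and ev: "\<And>\<mu>. eigenvalue M \<mu> \<Longrightarrow> \<mu> \<noteq> 0 \<Longrightarrow> \<mu> \<in> E"
  shows "sum_list (diag_mat M) = (\<Sum>\<mu>\<in>E. \<mu> * of_nat (dim_gen_eigenspace M \<mu> n))"
proof -
  obtain n_as where jnf: "jordan_nf M n_as"
    using complex_jordan_nf_exists[OF M] .
  have a: "a \<in> E \<or> of_nat k * a = 0" if ka: "(k, a) \<in> set n_as" for k a
  proof -
    have "k \<noteq> 0"
      using jnf ka by (force simp: jordan_nf_def)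
    then have "poly (char_poly M) a = 0"
      using ka by (force simp: jordan_nf_char_poly[OF jnf] poly_prod_list prod_list_zero_iff)
    then show ?thesis
      using ev[of a] eigenvalue_root_char_poly[OF M] by auto
  qed
  have "sum_list (diag_mat M) = (\<Sum>(k, a)\<leftarrow>n_as. of_nat k * a)"
    using sum_list_diag_mat_similar[of M "jordan_matrix n_as"] jnf
    by (simp add: sum_list_diag_jordan_matrix jordan_nf_def)
  also have "\<dots> = (\<Sum>a\<in>E. \<Sum>k\<leftarrow>map fst [(k, e)\<leftarrow>n_as. e = a]. of_nat k * a)"
    by (rule sum_list_map_eq_sum_group[OF E]) (use a in auto)
  also have "\<dots> = (\<Sum>a\<in>E. a * of_nat (dim_gen_eigenspace M a n))"
    by (simp only: dim_gen_eigenspace_stable[OF M jnf order_refl] map_map flip: sum_list_of_nat)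
       (simp add: sum_list_const_mult mult.commute comp_def)
  finally show ?thesis .
qed

lemma (in kernel) Ker_fin_dim: "Ker.fin_dim"
proof -
  have sub: "mat_kernel A \<subseteq> carrier_vec nc"
    using A by (rule mat_kernel_carrier)
  have li: "finite S \<and> card S \<le> nc" if "S \<subseteq> mat_kernel A" "lin_indpt S" for S
    using NC.li_le_dim[OF NC.fin_dim, of S] that sub lindep_same[of S] NC.dim_is_n by auto
  have "\<exists>S. finite S \<and> maximal S (\<lambda>S. S \<subseteq> mat_kernel A \<and> lin_indpt S)"
    by (rule maximal_exists[where ?N = nc and ?B = "{}"]) (use li in \<open>auto simp: Ker.lin_dep_def\<close>)
  then obtain S where S: "finite S" "maximal S (\<lambda>S. S \<subseteq> mat_kernel A \<and> lin_indpt S)"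
    by blast
  then have "basis S"
    by (intro Ker.max_li_is_basis) auto
  then show ?thesis
    using S(1) unfolding Ker.fin_dim_def Ker.basis_def by auto
qed

lemma mult_mat_zero_vec:
  fixes A :: "'a :: field mat"
  assumes "A \<in> carrier_mat m n"
  shows "A *\<^sub>v 0\<^sub>v n = 0\<^sub>v m"
  using assms by (intro eq_vecI) auto

lemma pow_mat_mult_vec:
  fixes A :: "'a :: field mat"
  assumes A: "A \<in> carrier_mat n n" and v: "v \<in> carrier_vec n"
  shows "A ^\<^sub>m k *\<^sub>v v = ((\<lambda>w. A *\<^sub>v w) ^^ k) v"
  using v
proof (induction k arbitrary: v)
  case (Suc k)
  have "A ^\<^sub>m Suc k *\<^sub>v v = A ^\<^sub>m k *\<^sub>v (A *\<^sub>v v)"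
    using A Suc.prems by (simp add: assoc_mult_mat_vec[of _ n n _ n])
  then show ?case
    using Suc A by (simp add: funpow_swap1)
qed (use A in auto)

lemma mat_kernel_pow:
  fixes A :: "'a :: field mat"
  assumes A: "A \<in> carrier_mat n n"
  shows "mat_kernel (A ^\<^sub>m k) = {v \<in> carrier_vec n. ((\<lambda>w. A *\<^sub>v w) ^^ k) v = 0\<^sub>v n}"
  using pow_mat_mult_vec[OF A] A by (auto simp: mat_kernel[of _ n n])

lemma mat_kernel_pow_mono:
  fixes A :: "'a :: field mat"
  assumes A: "A \<in> carrier_mat n n" and "j \<le> k"
  shows "mat_kernel (A ^\<^sub>m j) \<subseteq> mat_kernel (A ^\<^sub>m k)"
  using \<open>j \<le> k\<close>
proof (induction rule: dec_induct)
  case (step i)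
  moreover have "mat_kernel (A ^\<^sub>m i) \<subseteq> mat_kernel (A ^\<^sub>m Suc i)"
    using A by (auto simp: mat_kernel_pow mult_mat_zero_vec[OF A] simp del: pow_mat.simps)
  ultimately show ?case
    by blast
qed simp

text \<open>
  The kernels of the powers of \<open>M - \<mu> I\<close> increase, and their dimensions are constant from the
  exponent \<open>n\<close> onwards.
\<close>

lemma mat_kernel_char_matrix_stable:
  fixes M :: "complex mat"
  assumes M: "M \<in> carrier_mat n n"
  shows "mat_kernel (char_matrix M \<mu> ^\<^sub>m k) \<subseteq> mat_kernel (char_matrix M \<mu> ^\<^sub>m n)"
proof (cases "k \<le> n")
  case True
  then show ?thesis
    using M by (intro mat_kernel_pow_mono[of _ n]) auto
next
  case False
  let ?A = "char_matrix M \<mu> ^\<^sub>m n" and ?B = "char_matrix M \<mu> ^\<^sub>m k"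
  have "?A \<in> carrier_mat n n" "?B \<in> carrier_mat n n"
    using M by auto
  then interpret K: kernel n n ?A + L: kernel n n ?B
    by unfold_locales
  have sub: "mat_kernel ?A \<subseteq> mat_kernel ?B"
    using M False by (intro mat_kernel_pow_mono[of _ n]) auto
  obtain n_as where jnf: "jordan_nf M n_as"
    using complex_jordan_nf_exists[OF M] .
  have dim: "K.dim = L.dim"
    using dim_gen_eigenspace_stable[OF M jnf, of n \<mu>] dim_gen_eigenspace_stable[OF M jnf, of k \<mu>] False
    by (simp add: dim_gen_eigenspace_def)
  obtain S where S: "finite S" "K.basis S"
    using K.Ker.finite_basis_exists[OF K.Ker_fin_dim] by blast
  then have SA: "S \<subseteq> mat_kernel ?A" and "card S = K.dim"
    by (auto simp: K.Ker.basis_def K.Ker.dim_basis)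
  moreover have "L.lin_indpt S"
    using S SA sub K.lindep_same[of S] L.lindep_same[of S] by (auto simp: K.Ker.basis_def)
  ultimately have "L.basis S"
    using S sub dim by (intro L.Ker.dim_li_is_basis L.Ker_fin_dim) auto
  then show ?thesis
    using S SA sub K.span_same[of S] L.span_same[of S]
    by (auto simp: K.Ker.basis_def L.Ker.basis_def)
qed

section \<open>Linear endomorphisms of a complex vector space\<close>

context complex_banach_space
begin

lemma smult_mem [simp, intro]: "y \<in> carrier X \<Longrightarrow> (a :: complex) \<odot>\<^bsub>X\<^esub> y \<in> carrier X"
  by (rule smult_closed) auto

lemma smult_smult: "y \<in> carrier X \<Longrightarrow> (a :: complex) \<odot>\<^bsub>X\<^esub> (b \<odot>\<^bsub>X\<^esub> y) = (a * b) \<odot>\<^bsub>X\<^esub> y"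
  using smult_assoc1[of a b y] by simp

lemma smult_add_left:
  "y \<in> carrier X \<Longrightarrow> ((a :: complex) + b) \<odot>\<^bsub>X\<^esub> y = a \<odot>\<^bsub>X\<^esub> y \<oplus>\<^bsub>X\<^esub> b \<odot>\<^bsub>X\<^esub> y"
  using smult_l_distr[of a b y] by simp

lemma smult_add_right:
  "y \<in> carrier X \<Longrightarrow> z \<in> carrier X \<Longrightarrow>
    (a :: complex) \<odot>\<^bsub>X\<^esub> (y \<oplus>\<^bsub>X\<^esub> z) = a \<odot>\<^bsub>X\<^esub> y \<oplus>\<^bsub>X\<^esub> a \<odot>\<^bsub>X\<^esub> z"
  using smult_r_distr[of a y z] by simp

lemma smult_1 [simp]: "y \<in> carrier X \<Longrightarrow> (1 :: complex) \<odot>\<^bsub>X\<^esub> y = y"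
  using smult_one[of y] by simp

lemma smult_0 [simp]: "y \<in> carrier X \<Longrightarrow> (0 :: complex) \<odot>\<^bsub>X\<^esub> y = \<zero>\<^bsub>X\<^esub>"
  using smult_l_null[of y] by simp

lemma smult_zero [simp]: "(a :: complex) \<odot>\<^bsub>X\<^esub> \<zero>\<^bsub>X\<^esub> = \<zero>\<^bsub>X\<^esub>"
  using smult_r_null[of a] by simp

lemma diff_eq_add_smult:
  "y \<in> carrier X \<Longrightarrow> z \<in> carrier X \<Longrightarrow>
    y \<ominus>\<^bsub>X\<^esub> a \<odot>\<^bsub>X\<^esub> z = y \<oplus>\<^bsub>X\<^esub> (- a :: complex) \<odot>\<^bsub>X\<^esub> z"
  using smult_l_minus[of a z]
  by (simp add: a_minus_def class_ring_simps)

lemma smult_eq_zero_iff: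
  assumes "y \<in> carrier X"
  shows "(a :: complex) \<odot>\<^bsub>X\<^esub> y = \<zero>\<^bsub>X\<^esub> \<longleftrightarrow> a = 0 \<or> y = \<zero>\<^bsub>X\<^esub>"
proof
  assume 0: "a \<odot>\<^bsub>X\<^esub> y = \<zero>\<^bsub>X\<^esub>"
  have "y = inverse a \<odot>\<^bsub>X\<^esub> (a \<odot>\<^bsub>X\<^esub> y)" if "a \<noteq> 0"
    using that assms by (simp add: smult_smult)
  then show "a = 0 \<or> y = \<zero>\<^bsub>X\<^esub>"
    using 0 by auto
qed (use assms in auto)

end

text \<open>
  Linear maps from \<open>X\<close> to itself. Only the values on the carrier matter, unlike for
  \<^const>\<open>bounded_ops\<close>; this makes the notion stable under composition.
\<close>

definition linear_endo :: "'a nspace \<Rightarrow> ('a \<Rightarrow> 'a) \<Rightarrow> bool" where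
  "linear_endo X u \<longleftrightarrow> u \<in> module_hom (class_ring :: complex ring) X X"

context complex_banach_space
begin

lemma linear_endoI:
  assumes "\<And>y. y \<in> carrier X \<Longrightarrow> u y \<in> carrier X"
    and "\<And>y z. y \<in> carrier X \<Longrightarrow> z \<in> carrier X \<Longrightarrow> u (y \<oplus>\<^bsub>X\<^esub> z) = u y \<oplus>\<^bsub>X\<^esub> u z"
    and "\<And>a y. y \<in> carrier X \<Longrightarrow> u (a \<odot>\<^bsub>X\<^esub> y) = a \<odot>\<^bsub>X\<^esub> u y"
  shows "linear_endo X u"
  using assms by (auto simp: linear_endo_def module_hom_def)

lemma linear_endoD:
  assumes "linear_endo X u" "y \<in> carrier X"
  shows "u y \<in> carrier X" "z \<in> carrier X \<Longrightarrow> u (y \<oplus>\<^bsub>X\<^esub> z) = u y \<oplus>\<^bsub>X\<^esub> u z"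
    "u (a \<odot>\<^bsub>X\<^esub> y) = a \<odot>\<^bsub>X\<^esub> u y"
  using assms by (auto simp: linear_endo_def module_hom_def)

lemma linear_endo_zero: "linear_endo X u \<Longrightarrow> u \<zero>\<^bsub>X\<^esub> = \<zero>\<^bsub>X\<^esub>"
  using linear_endoD(3)[of u "\<zero>\<^bsub>X\<^esub>" 0] linear_endoD(1)[of u "\<zero>\<^bsub>X\<^esub>"] by simp

lemma linear_endo_funpow: "linear_endo X u \<Longrightarrow> linear_endo X (u ^^ n)"
  by (induction n) (auto intro!: linear_endoI simp: linear_endoD)

lemma linear_endo_shift:
  assumes "linear_endo X u"
  shows "linear_endo X (\<lambda>y. u y \<ominus>\<^bsub>X\<^esub> (\<mu> :: complex) \<odot>\<^bsub>X\<^esub> y)"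
  using assms
  by (intro linear_endoI; simp add: linear_endoD diff_eq_add_smult)
    (simp_all add: linear_endoD smult_add_right smult_smult a_ac mult.commute)

text \<open>
  On the generalized eigenspace of a nonzero eigenvalue \<open>\<mu>\<close>, the operator \<open>u\<close> is surjective. This is
  proved for each exponent separately, so no finiteness of dimension is needed.
\<close>

lemma generalized_eigenvector_preimage:
  fixes \<mu> :: complex
  assumes L_def: "L = (\<lambda>y. u y \<ominus>\<^bsub>X\<^esub> \<mu> \<odot>\<^bsub>X\<^esub> y)"
    and u: "linear_endo X u" and "\<mu> \<noteq> 0"
    and "y \<in> carrier X" "(L ^^ n) y = \<zero>\<^bsub>X\<^esub>"
  shows "\<exists>w\<in>carrier X. (L ^^ n) w = \<zero>\<^bsub>X\<^esub> \<and> u w = y"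
  using assms(4,5)
proof (induction n arbitrary: y)
  case 0
  then show ?case
    using linear_endo_zero[OF u] by auto
next
  case (Suc n)
  have L: "linear_endo X L"
    unfolding L_def using u by (rule linear_endo_shift)
  note Ln = linear_endo_funpow[OF L, of "Suc n"]
  have Ly: "L y \<in> carrier X" "L y = u y \<oplus>\<^bsub>X\<^esub> (- \<mu>) \<odot>\<^bsub>X\<^esub> y" and uy: "u y \<in> carrier X"
    using Suc.prems L u by (auto simp: linear_endoD L_def diff_eq_add_smult)
  have "(L ^^ n) (L y) = \<zero>\<^bsub>X\<^esub>"
    using Suc.prems(2) by (simp add: funpow_swap1)
  then obtain v where v: "v \<in> carrier X" "(L ^^ n) v = \<zero>\<^bsub>X\<^esub>" "u v = L y"
    using Suc.IH[OF Ly(1)] by blast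
  \<comment> \<open>From \<open>u v = u y - \<mu> y\<close> follows \<open>y = u ((y - v) / \<mu>)\<close>.\<close>
  define w where "w = inverse \<mu> \<odot>\<^bsub>X\<^esub> (y \<oplus>\<^bsub>X\<^esub> (- 1) \<odot>\<^bsub>X\<^esub> v)"
  have w: "w \<in> carrier X"
    using v Suc.prems by (simp add: w_def)
  have "u w = inverse \<mu> \<odot>\<^bsub>X\<^esub> (u y \<oplus>\<^bsub>X\<^esub> (- 1) \<odot>\<^bsub>X\<^esub> (u y \<oplus>\<^bsub>X\<^esub> (- \<mu>) \<odot>\<^bsub>X\<^esub> y))"
    using u v Suc.prems Ly by (simp add: w_def linear_endoD)
  also have "u y \<oplus>\<^bsub>X\<^esub> (- 1) \<odot>\<^bsub>X\<^esub> (u y \<oplus>\<^bsub>X\<^esub> (- \<mu>) \<odot>\<^bsub>X\<^esub> y) =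
      (1 \<odot>\<^bsub>X\<^esub> u y \<oplus>\<^bsub>X\<^esub> (- 1) \<odot>\<^bsub>X\<^esub> u y) \<oplus>\<^bsub>X\<^esub> \<mu> \<odot>\<^bsub>X\<^esub> y"
    using uy Suc.prems by (simp add: smult_add_right smult_smult a_assoc)
  also have "\<dots> = \<mu> \<odot>\<^bsub>X\<^esub> y"
    using uy Suc.prems(1) by (subst smult_add_left[symmetric]) simp_all
  finally have "u w = y"
    using \<open>\<mu> \<noteq> 0\<close> Suc.prems by (simp add: smult_smult)
  moreover have "(L ^^ Suc n) v = \<zero>\<^bsub>X\<^esub>"
    using v(2) linear_endo_zero[OF L] by simp
  then have "(L ^^ Suc n) w = \<zero>\<^bsub>X\<^esub>"
    using v Suc.prems by (simp add: w_def linear_endoD[OF Ln] del: funpow.simps)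
  ultimately show ?case
    using w by blast
qed

end

section \<open>Finite rank operators factor through matrices\<close>

text \<open>
  A finite rank operator together with a representation \<open>u = \<Sum>\<^sub>k f\<^sub>k \<otimes> x\<^sub>k\<close>.
\<close>

locale finite_rank_operator = complex_banach_space X for X :: "'a nspace" +
  fixes N :: nat and f :: "nat \<Rightarrow> 'a \<Rightarrow> complex" and x :: "nat \<Rightarrow> 'a" and u :: "'a \<Rightarrow> 'a"
  assumes rep: "finite_rank_rep X N f x u"
begin

text \<open>
  The two factors \<open>synth : \<complex>\<^sup>N \<rightarrow> X\<close> and \<open>coords : X \<rightarrow> \<complex>\<^sup>N\<close> satisfy \<open>u = synth \<circ> coords\<close>, and \<open>M\<close> is the matrix
  of \<open>coords \<circ> synth\<close>.
\<close>

definition synth :: "complex vec \<Rightarrow> 'a" where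
  "synth c = (\<Oplus>\<^bsub>X\<^esub>k\<in>{..<N}. c $ k \<odot>\<^bsub>X\<^esub> x k)"

definition coords :: "'a \<Rightarrow> complex vec" where
  "coords y = vec N (\<lambda>j. f j y)"

definition M :: "complex mat" where
  "M = mat N N (\<lambda>(j, k). f j (x k))"

lemma M_carrier [simp]: "M \<in> carrier_mat N N"
  by (simp add: M_def)

lemma coords_carrier [simp]: "coords y \<in> carrier_vec N"
  by (simp add: coords_def)

lemma x_mem [simp]: "k < N \<Longrightarrow> x k \<in> carrier X"
  using rep by (simp add: finite_rank_rep_def)

lemma f_add: "k < N \<Longrightarrow> y \<in> carrier X \<Longrightarrow> z \<in> carrier X \<Longrightarrow> f k (y \<oplus>\<^bsub>X\<^esub> z) = f k y + f k z"
  and f_smult: "k < N \<Longrightarrow> y \<in> carrier X \<Longrightarrow> f k (a \<odot>\<^bsub>X\<^esub> y) = a * f k y"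
  using rep
  by (auto simp: finite_rank_rep_def dual_def bounded_ops_def module_hom_def scalar_space_def)

lemma f_zero [simp]: "k < N \<Longrightarrow> f k \<zero>\<^bsub>X\<^esub> = 0"
  using f_smult[of k "\<zero>\<^bsub>X\<^esub>" 0] by simp

lemma f_finsum:
  assumes "j < N" "finite B" "\<And>k. k \<in> B \<Longrightarrow> g k \<in> carrier X"
  shows "f j (\<Oplus>\<^bsub>X\<^esub>k\<in>B. g k) = (\<Sum>k\<in>B. f j (g k))"
  using assms(2,3)
proof (induction rule: finite_induct)
  case (insert k B)
  then have "(\<Oplus>\<^bsub>X\<^esub>i\<in>insert k B. g i) = g k \<oplus>\<^bsub>X\<^esub> (\<Oplus>\<^bsub>X\<^esub>i\<in>B. g i)"
    by (intro finsum_insert) auto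
  moreover have "(\<Oplus>\<^bsub>X\<^esub>i\<in>B. g i) \<in> carrier X"
    using insert by (intro finsum_closed) auto
  ultimately show ?case
    using insert assms(1) by (simp add: f_add)
qed (use assms(1) in simp)

lemma synth_mem [simp]: "synth c \<in> carrier X"
  unfolding synth_def by (intro finsum_closed) auto

lemma synth_add:
  assumes "c \<in> carrier_vec N" "d \<in> carrier_vec N"
  shows "synth (c + d) = synth c \<oplus>\<^bsub>X\<^esub> synth d"
proof -
  have "synth (c + d) = (\<Oplus>\<^bsub>X\<^esub>k\<in>{..<N}. c $ k \<odot>\<^bsub>X\<^esub> x k \<oplus>\<^bsub>X\<^esub> d $ k \<odot>\<^bsub>X\<^esub> x k)"
    unfolding synth_def using assms by (intro finsum_cong2) (auto simp: smult_add_left)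
  also have "\<dots> = synth c \<oplus>\<^bsub>X\<^esub> synth d"
    unfolding synth_def by (intro finsum_addf) auto
  finally show ?thesis .
qed

lemma synth_smult:
  assumes "c \<in> carrier_vec N"
  shows "synth (a \<cdot>\<^sub>v c) = a \<odot>\<^bsub>X\<^esub> synth c"
proof -
  have "synth (a \<cdot>\<^sub>v c) = (\<Oplus>\<^bsub>X\<^esub>k\<in>{..<N}. a \<odot>\<^bsub>X\<^esub> (c $ k \<odot>\<^bsub>X\<^esub> x k))"
    unfolding synth_def using assms by (intro finsum_cong2) (auto simp: smult_smult)
  also have "\<dots> = a \<odot>\<^bsub>X\<^esub> synth c"
    unfolding synth_def by (intro finsum_smult_ldistr[symmetric]) auto
  finally show ?thesis .
qed

lemma synth_zero [simp]: "synth (0\<^sub>v N) = \<zero>\<^bsub>X\<^esub>"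
proof -
  have "(0 :: complex) \<cdot>\<^sub>v 0\<^sub>v N = 0\<^sub>v N"
    by (intro eq_vecI) auto
  then show ?thesis
    using synth_smult[of "0\<^sub>v N" 0] by simp
qed

lemma coords_add: "y \<in> carrier X \<Longrightarrow> z \<in> carrier X \<Longrightarrow> coords (y \<oplus>\<^bsub>X\<^esub> z) = coords y + coords z"
  by (auto simp: coords_def f_add)

lemma coords_smult: "y \<in> carrier X \<Longrightarrow> coords (a \<odot>\<^bsub>X\<^esub> y) = a \<cdot>\<^sub>v coords y"
  by (auto simp: coords_def f_smult)

lemma coords_zero [simp]: "coords \<zero>\<^bsub>X\<^esub> = 0\<^sub>v N"
  by (auto simp: coords_def)

lemma synth_coords: "y \<in> carrier X \<Longrightarrow> synth (coords y) = u y"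
  using rep unfolding finite_rank_rep_def synth_def coords_def
  by (auto intro!: finsum_cong2)

lemma coords_synth:
  assumes "c \<in> carrier_vec N"
  shows "coords (synth c) = M *\<^sub>v c"
proof (rule eq_vecI)
  fix j assume "j < dim_vec (M *\<^sub>v c)"
  then have j: "j < N"
    by (simp add: M_def)
  have "f j (synth c) = (\<Sum>k<N. f j (c $ k \<odot>\<^bsub>X\<^esub> x k))"
    unfolding synth_def using j by (intro f_finsum) auto
  then have "coords (synth c) $ j = (\<Sum>k<N. c $ k * f j (x k))"
    using j by (simp add: coords_def f_smult)
  also have "\<dots> = (M *\<^sub>v c) $ j"
    using assms j by (auto simp: M_def scalar_prod_def lessThan_atLeast0 mult.commute intro!: sum.cong)
  finally show "coords (synth c) $ j = (M *\<^sub>v c) $ j" .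
qed (simp add: coords_def M_def)

lemma u_linear: "linear_endo X u"
  by (rule linear_endoI)
    (simp_all add: synth_coords[symmetric] coords_add coords_smult synth_add synth_smult)

abbreviation L :: "complex \<Rightarrow> 'a \<Rightarrow> 'a" where
  "L \<mu> \<equiv> \<lambda>y. u y \<ominus>\<^bsub>X\<^esub> \<mu> \<odot>\<^bsub>X\<^esub> y"

lemma smult_mat_mult_vec:
  fixes A :: "complex mat"
  assumes "A \<in> carrier_mat m n" "v \<in> carrier_vec n"
  shows "(k \<cdot>\<^sub>m A) *\<^sub>v v = k \<cdot>\<^sub>v (A *\<^sub>v v)"
  using assms by (intro eq_vecI) auto

lemma char_matrix_mult_vec:
  "c \<in> carrier_vec N \<Longrightarrow> char_matrix M \<mu> *\<^sub>v c = M *\<^sub>v c + (- \<mu>) \<cdot>\<^sub>v c"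
  by (simp add: char_matrix_def add_mult_distrib_mat_vec[of _ N N] carrier_matD[OF M_carrier]
      smult_mat_mult_vec[of _ N N])

lemma synth_char_matrix:
  assumes "c \<in> carrier_vec N"
  shows "synth (((\<lambda>c. char_matrix M \<mu> *\<^sub>v c) ^^ n) c) = (L \<mu> ^^ n) (synth c)"
  using assms
proof (induction n arbitrary: c)
  case (Suc n)
  have Mc: "M *\<^sub>v c \<in> carrier_vec N" "char_matrix M \<mu> *\<^sub>v c \<in> carrier_vec N"
    using Suc.prems by (auto intro!: mult_mat_vec_carrier[of _ _ N])
  have "synth (char_matrix M \<mu> *\<^sub>v c) = L \<mu> (synth c)"
    using Suc.prems Mc
    by (simp add: char_matrix_mult_vec synth_add synth_smult diff_eq_add_smult linear_endoD[OF u_linear])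
      (simp add: synth_coords flip: coords_synth)
  then show ?case
    using Suc.IH[OF Mc(2)] by (simp add: funpow_Suc_right del: funpow.simps)
qed simp

lemma coords_shift:
  assumes "y \<in> carrier X"
  shows "coords ((L \<mu> ^^ n) y) = ((\<lambda>c. char_matrix M \<mu> *\<^sub>v c) ^^ n) (coords y)"
  using assms
proof (induction n arbitrary: y)
  case (Suc n)
  have "coords (L \<mu> y) = char_matrix M \<mu> *\<^sub>v coords y"
    using Suc.prems
    by (simp add: char_matrix_mult_vec diff_eq_add_smult linear_endoD[OF u_linear] coords_add coords_smult)
      (simp flip: coords_synth synth_coords)
  moreover have "L \<mu> y \<in> carrier X"
    using linear_endoD(1)[OF linear_endo_shift[OF u_linear] Suc.prems] .
  ultimately show ?case
    using Suc.IH by (simp add: funpow_Suc_right del: funpow.simps)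
qed simp

lemma generalized_eigenspace_eq:
  assumes "\<mu> \<noteq> 0"
  shows "generalized_eigenspace X u \<mu> = synth ` mat_kernel (char_matrix M \<mu> ^\<^sub>m N)"
proof (intro equalityI subsetI)
  fix y assume "y \<in> synth ` mat_kernel (char_matrix M \<mu> ^\<^sub>m N)"
  then show "y \<in> generalized_eigenspace X u \<mu>"
    by (auto simp: generalized_eigenspace_def mat_kernel_pow[of _ N] intro!: exI[of _ N]
        simp flip: synth_char_matrix)
next
  fix y assume "y \<in> generalized_eigenspace X u \<mu>"
  then obtain n where "y \<in> carrier X" "(L \<mu> ^^ n) y = \<zero>\<^bsub>X\<^esub>"
    by (auto simp: generalized_eigenspace_def)
  then obtain w where w: "w \<in> carrier X" "(L \<mu> ^^ n) w = \<zero>\<^bsub>X\<^esub>" "u w = y"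
    using generalized_eigenvector_preimage[OF refl u_linear assms] by blast
  then have "coords w \<in> mat_kernel (char_matrix M \<mu> ^\<^sub>m n)"
    by (simp add: mat_kernel_pow[of _ N] flip: coords_shift)
  then have "coords w \<in> mat_kernel (char_matrix M \<mu> ^\<^sub>m N)"
    using mat_kernel_char_matrix_stable[OF M_carrier] by blast
  then show "y \<in> synth ` mat_kernel (char_matrix M \<mu> ^\<^sub>m N)"
    using w synth_coords[OF w(1)] by (metis image_eqI)
qed

text \<open>
  On the kernel of \<open>synth\<close> the matrix \<open>M\<close> vanishes, so \<open>M - \<mu> I\<close> acts there as multiplication by \<open>-\<mu>\<close>.
\<close>

lemma synth_eq_zero:
  assumes "\<mu> \<noteq> 0" "c \<in> mat_kernel (char_matrix M \<mu> ^\<^sub>m N)" "synth c = \<zero>\<^bsub>X\<^esub>"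
  shows "c = 0\<^sub>v N"
proof -
  have c: "c \<in> carrier_vec N" "((\<lambda>c. char_matrix M \<mu> *\<^sub>v c) ^^ N) c = 0\<^sub>v N"
    using assms(2) by (auto simp: mat_kernel_pow[of _ N])
  have "M *\<^sub>v c = 0\<^sub>v N"
    using coords_synth[OF c(1)] assms(3) by simp
  then have "char_matrix M \<mu> *\<^sub>v c = (- \<mu>) \<cdot>\<^sub>v c"
    using c by (simp add: char_matrix_mult_vec)
  then have "((\<lambda>c. char_matrix M \<mu> *\<^sub>v c) ^^ n) c = (- \<mu>) ^ n \<cdot>\<^sub>v c" for n
    using c(1) by (induction n)
      (simp_all add: mult_mat_vec[of _ N N] smult_smult_assoc mult.commute)
  with c show ?thesis
    using assms(1) by (auto simp: vec_eq_iff)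
qed

lemma alg_mult_eq:
  assumes "\<mu> \<noteq> 0"
  shows "alg_mult X u \<mu> = dim_gen_eigenspace M \<mu> N"
proof -
  let ?A = "char_matrix M \<mu> ^\<^sub>m N"
  have A: "?A \<in> carrier_mat N N"
    by simp
  interpret K: kernel N N ?A
    by unfold_locales (rule A)
  have sub: "mat_kernel ?A \<subseteq> carrier_vec N"
    by (rule mat_kernel_carrier[OF A])
  interpret T: linear_map "class_ring :: complex ring" K.VK X synth
    by unfold_locales (use sub in \<open>auto simp: module_hom_def synth_add synth_smult subset_iff module_vec_simps\<close>)
  have "T.im = generalized_eigenspace X u \<mu>"
    using generalized_eigenspace_eq[OF assms] by (simp add: T.im_def)
  moreover have "0\<^sub>v N \<in> mat_kernel ?A"
    by (intro mat_kernelI[OF A] mult_mat_zero_vec[OF A]) auto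
  then have "T.ker = {0\<^sub>v N}"
    using synth_eq_zero[OF assms] unfolding T.ker_def by auto
  then have "inj_on synth (carrier K.VK)"
    by (intro T.Ke0_imp_inj) (simp add: module_vec_simps)
  then have "vectorspace.dim (class_ring :: complex ring) (K.VK\<lparr>carrier := T.ker\<rparr>) = 0"
    by (rule T.inj_imp_dim_ker0)
  ultimately show ?thesis
    using T.rank_nullity K.Ker_fin_dim
    by (simp add: alg_mult_def dim_gen_eigenspace_def)
qed

lemma eigenvalue_M:
  assumes "\<mu> \<noteq> 0"
  shows "eigenvalue M \<mu> \<longleftrightarrow> \<mu> \<in> eigenvalues X u"
proof
  assume "eigenvalue M \<mu>"
  then obtain c where c: "c \<in> carrier_vec N" "c \<noteq> 0\<^sub>v N" "M *\<^sub>v c = \<mu> \<cdot>\<^sub>v c"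
    by (auto simp: eigenvalue_def eigenvector_def carrier_matD[OF M_carrier])
  have "u (synth c) = \<mu> \<odot>\<^bsub>X\<^esub> synth c"
    using c by (simp add: synth_smult flip: synth_coords) (simp add: coords_synth synth_smult)
  moreover have "synth c \<noteq> \<zero>\<^bsub>X\<^esub>"
    using c coords_synth[OF c(1)] assms by (auto simp: vec_eq_iff)
  ultimately show "\<mu> \<in> eigenvalues X u"
    unfolding eigenvalues_def using synth_mem by blast
next
  assume "\<mu> \<in> eigenvalues X u"
  then obtain y where y: "y \<in> carrier X" "y \<noteq> \<zero>\<^bsub>X\<^esub>" "u y = \<mu> \<odot>\<^bsub>X\<^esub> y"
    by (auto simp: eigenvalues_def)
  have "M *\<^sub>v coords y = \<mu> \<cdot>\<^sub>v coords y"
    using y by (simp add: synth_coords coords_smult flip: coords_synth)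
  moreover have "coords y \<noteq> 0\<^sub>v N"
  proof
    assume "coords y = 0\<^sub>v N"
    then have "\<mu> \<odot>\<^bsub>X\<^esub> y = \<zero>\<^bsub>X\<^esub>"
      using synth_coords[OF y(1)] y(3) by simp
    then show False
      using y assms by (simp add: smult_eq_zero_iff)
  qed
  ultimately show "eigenvalue M \<mu>"
    unfolding eigenvalue_def eigenvector_def
    by (intro exI[of _ "coords y"]) (simp add: carrier_matD[OF M_carrier])
qed

lemma finite_eigenvalues: "finite (eigenvalues X u)"
proof (rule finite_subset)
  have "{\<mu>. eigenvalue M \<mu>} = {\<mu>. poly (char_poly M) \<mu> = 0}"
    using eigenvalue_root_char_poly[OF M_carrier] by simp
  moreover have "char_poly M \<noteq> 0"
    using degree_monic_char_poly[OF M_carrier] by auto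
  ultimately show "finite (insert 0 {\<mu>. eigenvalue M \<mu>})"
    by (simp add: poly_roots_finite)
qed (use eigenvalue_M in auto)

text \<open>
  The eigenvalue \<open>0\<close>, whose multiplicity is not controlled, contributes \<open>0\<close> on the left.
\<close>

lemma sum_eigenvalues_eq:
  "(\<Sum>\<mu>\<in>eigenvalues X u. \<mu> * of_nat (alg_mult X u \<mu>)) = (\<Sum>k<N. f k (x k))"
proof -
  have "(\<Sum>k<N. f k (x k)) = sum_list (diag_mat M)"
    by (auto simp: diag_mat_def M_def sum_list_distinct_conv_sum_set lessThan_atLeast0 intro!: sum.cong)
  also have "\<dots> = (\<Sum>\<mu>\<in>eigenvalues X u. \<mu> * of_nat (dim_gen_eigenspace M \<mu> N))"
    by (rule sum_list_diag_mat_eq_sum_eigenvalues[OF M_carrier finite_eigenvalues])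
      (simp add: eigenvalue_M)
  also have "\<dots> = (\<Sum>\<mu>\<in>eigenvalues X u. \<mu> * of_nat (alg_mult X u \<mu>))"
    by (rule sum.cong) (auto, metis alg_mult_eq)
  finally show ?thesis ..
qed

end

section \<open>The trace and the determinant of finite rank operators\<close>

context complex_banach_space
begin

lemma op_trace_rep:
  assumes "finite_rank_rep X N f x u"
  shows "op_trace X u = (\<Sum>k<N. f k (x k))"
proof -
  have "(\<Sum>k<N'. f' k (x' k)) = (\<Sum>\<mu>\<in>eigenvalues X u. \<mu> * of_nat (alg_mult X u \<mu>))"
    if "finite_rank_rep X N' f' x' u" for N' f' x'
  proof -
    interpret finite_rank_operator X N' f' x' u
      by unfold_locales (rule that)
    show ?thesis
      by (rule sum_eigenvalues_eq[symmetric])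
  qed
  then show ?thesis
    unfolding op_trace_def using assms by (intro the_equality) metis+
qed

lemma finite_rank_opsE:
  assumes "u \<in> finite_rank_ops X"
  obtains N f x where "finite_rank_operator X N f x u"
proof -
  from assms obtain N f x where "finite_rank_rep X N f x u"
    by (auto simp: finite_rank_ops_def)
  then have "finite_rank_operator X N f x u"
    by unfold_locales
  then show thesis ..
qed

lemma op_trace_eq_sum_eigenvalues:
  assumes "u \<in> finite_rank_ops X"
  shows "finite (eigenvalues X u)"
    and "op_trace X u = (\<Sum>\<mu>\<in>eigenvalues X u. \<mu> * of_nat (alg_mult X u \<mu>))"
proof -
  from assms obtain N f x where "finite_rank_operator X N f x u"
    by (rule finite_rank_opsE)
  then interpret finite_rank_operator X N f x u .
  show "finite (eigenvalues X u)"
    by (rule finite_eigenvalues)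
  show "op_trace X u = (\<Sum>\<mu>\<in>eigenvalues X u. \<mu> * of_nat (alg_mult X u \<mu>))"
    using op_trace_rep[OF rep] sum_eigenvalues_eq by simp
qed

lemma finite_rank_rep_zero: "finite_rank_rep X 0 f x (op_zero X X)"
  by (simp add: finite_rank_rep_def op_zero_def)

lemma op_zero_finite_rank: "op_zero X X \<in> finite_rank_ops X"
  unfolding finite_rank_ops_def using finite_rank_rep_zero by blast

lemma op_trace_zero: "op_trace X (op_zero X X) = 0"
  using op_trace_rep[OF finite_rank_rep_zero] by simp

lemma op_scale_finite_rank:
  assumes "u \<in> finite_rank_ops X"
  shows "op_scale X X c u \<in> finite_rank_ops X"
    and "op_trace X (op_scale X X c u) = c * op_trace X u"
proof -
  from assms obtain N f x where "finite_rank_operator X N f x u"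
    by (rule finite_rank_opsE)
  then interpret finite_rank_operator X N f x u .
  have "c \<odot>\<^bsub>X\<^esub> u y = (\<Oplus>\<^bsub>X\<^esub>k\<in>{..<N}. f k y \<odot>\<^bsub>X\<^esub> (c \<odot>\<^bsub>X\<^esub> x k))"
    if "y \<in> carrier X" for y
  proof -
    have "c \<odot>\<^bsub>X\<^esub> u y = (\<Oplus>\<^bsub>X\<^esub>k\<in>{..<N}. c \<odot>\<^bsub>X\<^esub> (f k y \<odot>\<^bsub>X\<^esub> x k))"
      using rep that unfolding finite_rank_rep_def
      by (auto intro!: finsum_smult_ldistr)
    also have "\<dots> = (\<Oplus>\<^bsub>X\<^esub>k\<in>{..<N}. f k y \<odot>\<^bsub>X\<^esub> (c \<odot>\<^bsub>X\<^esub> x k))"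
      by (intro finsum_cong2) (auto simp: smult_smult mult.commute)
    finally show ?thesis .
  qed
  then have *: "finite_rank_rep X N f (\<lambda>k. c \<odot>\<^bsub>X\<^esub> x k) (op_scale X X c u)"
    using rep by (auto simp: finite_rank_rep_def op_scale_def intro!: restrict_ext)
  then show "op_scale X X c u \<in> finite_rank_ops X"
    by (auto simp: finite_rank_ops_def)
  show "op_trace X (op_scale X X c u) = c * op_trace X u"
    by (simp add: op_trace_rep[OF *] op_trace_rep[OF rep] f_smult sum_distrib_left)
qed

lemma op_add_finite_rank:
  assumes "u \<in> finite_rank_ops X" "v \<in> finite_rank_ops X"
  shows "op_add X X u v \<in> finite_rank_ops X"
    and "op_trace X (op_add X X u v) = op_trace X u + op_trace X v"
proof -
  obtain N f x where u: "finite_rank_operator X N f x u"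
    using assms(1) by (rule finite_rank_opsE)
  obtain N' f' x' where v: "finite_rank_operator X N' f' x' v"
    using assms(2) by (rule finite_rank_opsE)
  interpret U: finite_rank_operator X N f x u
    by (rule u)
  interpret V: finite_rank_operator X N' f' x' v
    by (rule v)
  define g where "g k = (if k < N then f k else f' (k - N))" for k
  define z where "z k = (if k < N then x k else x' (k - N))" for k
  have split: "{..<N + N'} = {..<N} \<union> (+) N ` {..<N'}"
  proof (intro equalityI subsetI)
    fix k assume "k \<in> {..<N + N'}"
    then show "k \<in> {..<N} \<union> (+) N ` {..<N'}"
      by (cases "k < N") (auto intro!: image_eqI[of _ _ "k - N"])
  qed auto
  have disj: "{..<N} \<inter> (+) N ` {..<N'} = {}"
    by auto
  have z: "z k \<in> carrier X" if "k < N + N'" for k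
    using that U.x_mem[of k] V.x_mem[of "k - N"] by (auto simp: z_def)
  have g: "g k \<in> dual X" if "k < N + N'" for k
    using that U.rep V.rep by (auto simp: g_def finite_rank_rep_def)
  have "u y \<oplus>\<^bsub>X\<^esub> v y = (\<Oplus>\<^bsub>X\<^esub>k\<in>{..<N + N'}. g k y \<odot>\<^bsub>X\<^esub> z k)" if "y \<in> carrier X" for y
  proof -
    have "(\<Oplus>\<^bsub>X\<^esub>k\<in>{..<N + N'}. g k y \<odot>\<^bsub>X\<^esub> z k) =
        (\<Oplus>\<^bsub>X\<^esub>k\<in>{..<N}. g k y \<odot>\<^bsub>X\<^esub> z k) \<oplus>\<^bsub>X\<^esub> (\<Oplus>\<^bsub>X\<^esub>k\<in>(+) N ` {..<N'}. g k y \<odot>\<^bsub>X\<^esub> z k)"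
      unfolding split by (intro finsum_Un_disjoint disj) (auto simp: z)
    also have "(\<Oplus>\<^bsub>X\<^esub>k\<in>{..<N}. g k y \<odot>\<^bsub>X\<^esub> z k) = (\<Oplus>\<^bsub>X\<^esub>k\<in>{..<N}. f k y \<odot>\<^bsub>X\<^esub> x k)"
      by (intro finsum_cong2) (auto simp: g_def z_def)
    also have "\<dots> = u y"
      using U.rep that by (simp add: finite_rank_rep_def)
    also have "(\<Oplus>\<^bsub>X\<^esub>k\<in>(+) N ` {..<N'}. g k y \<odot>\<^bsub>X\<^esub> z k) =
        (\<Oplus>\<^bsub>X\<^esub>k\<in>{..<N'}. g (N + k) y \<odot>\<^bsub>X\<^esub> z (N + k))"
      by (intro finsum_reindex) (auto simp: z)
    also have "\<dots> = (\<Oplus>\<^bsub>X\<^esub>k\<in>{..<N'}. f' k y \<odot>\<^bsub>X\<^esub> x' k)"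
      by (intro finsum_cong2) (auto simp: g_def z_def)
    also have "\<dots> = v y"
      using V.rep that by (simp add: finite_rank_rep_def)
    finally show ?thesis ..
  qed
  then have *: "finite_rank_rep X (N + N') g z (op_add X X u v)"
    using g z by (auto simp: finite_rank_rep_def op_add_def intro!: restrict_ext)
  then show "op_add X X u v \<in> finite_rank_ops X"
    by (auto simp: finite_rank_ops_def)
  have "(\<Sum>k<N + N'. g k (z k)) = (\<Sum>k<N. f k (x k)) + (\<Sum>k<N'. f' k (x' k))"
    unfolding split
    by (subst sum.union_disjoint[OF _ _ disj]) (auto simp: sum.reindex g_def z_def)
  then show "op_trace X (op_add X X u v) = op_trace X u + op_trace X v"
    by (simp add: op_trace_rep[OF *] op_trace_rep[OF U.rep] op_trace_rep[OF V.rep])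
qed

lemma eigenvalues_scale:
  assumes u: "linear_endo X u" and z: "z \<noteq> 0"
  shows "eigenvalues X (op_scale X X z u) = (*) z ` eigenvalues X u"
proof -
  have *: "z \<odot>\<^bsub>X\<^esub> u y = (z * \<mu>) \<odot>\<^bsub>X\<^esub> y \<longleftrightarrow> u y = \<mu> \<odot>\<^bsub>X\<^esub> y" if "y \<in> carrier X" for y \<mu>
  proof
    assume "z \<odot>\<^bsub>X\<^esub> u y = (z * \<mu>) \<odot>\<^bsub>X\<^esub> y"
    then have "inverse z \<odot>\<^bsub>X\<^esub> (z \<odot>\<^bsub>X\<^esub> u y) = inverse z \<odot>\<^bsub>X\<^esub> ((z * \<mu>) \<odot>\<^bsub>X\<^esub> y)"
      by simp
    then show "u y = \<mu> \<odot>\<^bsub>X\<^esub> y"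
      using that z by (simp add: smult_smult linear_endoD[OF u] flip: mult.assoc)
  qed (use that in \<open>simp add: smult_smult\<close>)
  show ?thesis
  proof (intro equalityI subsetI)
    fix \<nu> assume "\<nu> \<in> eigenvalues X (op_scale X X z u)"
    then have "\<nu> / z \<in> eigenvalues X u"
      using *[of _ "\<nu> / z"] z by (auto simp: eigenvalues_def op_scale_def)
    then show "\<nu> \<in> (*) z ` eigenvalues X u"
      using z by (intro image_eqI[of _ _ "\<nu> / z"]) auto
  qed (use * in \<open>auto simp: eigenvalues_def op_scale_def\<close>)
qed

lemma generalized_eigenspace_scale:
  assumes u: "linear_endo X u" and z: "z \<noteq> 0"
  shows "generalized_eigenspace X (op_scale X X z u) (z * \<mu>) = generalized_eigenspace X u \<mu>"
proof -
  let ?L = "\<lambda>y. u y \<ominus>\<^bsub>X\<^esub> \<mu> \<odot>\<^bsub>X\<^esub> y"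
  let ?L' = "\<lambda>y. op_scale X X z u y \<ominus>\<^bsub>X\<^esub> (z * \<mu>) \<odot>\<^bsub>X\<^esub> y"
  have L: "linear_endo X ?L"
    using u by (rule linear_endo_shift)
  have step: "?L' y = z \<odot>\<^bsub>X\<^esub> ?L y" if "y \<in> carrier X" for y
    using that
    by (simp add: op_scale_def diff_eq_add_smult linear_endoD[OF u] smult_add_right smult_smult)
  have pow: "(?L' ^^ n) y = z ^ n \<odot>\<^bsub>X\<^esub> (?L ^^ n) y" if "y \<in> carrier X" for n y
  proof (induction n)
    case (Suc n)
    have mem: "(?L ^^ n) y \<in> carrier X"
      using linear_endoD(1)[OF linear_endo_funpow[OF L] that] .
    have "(?L' ^^ Suc n) y = z \<odot>\<^bsub>X\<^esub> ?L (z ^ n \<odot>\<^bsub>X\<^esub> (?L ^^ n) y)"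
      using Suc step[of "z ^ n \<odot>\<^bsub>X\<^esub> (?L ^^ n) y"] mem by simp
    also have "\<dots> = z \<odot>\<^bsub>X\<^esub> (z ^ n \<odot>\<^bsub>X\<^esub> ?L ((?L ^^ n) y))"
      using linear_endoD(3)[OF L mem] by simp
    also have "\<dots> = z ^ Suc n \<odot>\<^bsub>X\<^esub> (?L ^^ Suc n) y"
      using linear_endoD(1)[OF L mem] by (simp add: smult_smult)
    finally show ?case .
  qed (use that in simp)
  have "(?L' ^^ n) y = \<zero>\<^bsub>X\<^esub> \<longleftrightarrow> (?L ^^ n) y = \<zero>\<^bsub>X\<^esub>" if "y \<in> carrier X" for n y
    using z pow[OF that] linear_endoD(1)[OF linear_endo_funpow[OF L] that]
    by (simp add: smult_eq_zero_iff)
  then show ?thesis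
    unfolding generalized_eigenspace_def by auto
qed

text \<open>
  For \<open>z = 0\<close> the left-hand side is the determinant for the zero operator, whose only possible
  eigenvalue is \<open>0\<close>.
\<close>

lemma det_one_plus_scale:
  assumes u: "linear_endo X u"
  shows "det_one_plus X (op_scale X X z u) =
    (\<Prod>\<mu>\<in>eigenvalues X u. (1 + z * \<mu>) ^ alg_mult X u \<mu>)"
proof (cases "z = 0")
  case True
  have "\<mu> = 0" if "\<mu> \<in> eigenvalues X (op_scale X X 0 u)" for \<mu>
  proof -
    from that obtain y where y: "y \<in> carrier X" "y \<noteq> \<zero>\<^bsub>X\<^esub>" "0 \<odot>\<^bsub>X\<^esub> u y = \<mu> \<odot>\<^bsub>X\<^esub> y"
      by (auto simp: eigenvalues_def op_scale_def)
    then have "\<mu> \<odot>\<^bsub>X\<^esub> y = \<zero>\<^bsub>X\<^esub>"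
      by (simp add: linear_endoD[OF u])
    then show ?thesis
      using y smult_eq_zero_iff by blast
  qed
  then have "det_one_plus X (op_scale X X 0 u) = 1"
    unfolding det_one_plus_def by (intro prod.neutral ballI) fastforce
  then show ?thesis
    using True by simp
next
  case False
  then have "inj_on ((*) z) (eigenvalues X u)"
    by (auto simp: inj_on_def)
  then show ?thesis
    unfolding det_one_plus_def eigenvalues_scale[OF u False]
    by (simp add: prod.reindex alg_mult_def generalized_eigenspace_scale[OF u False])
qed

end

text \<open>
  Cauchy's inequality for the first derivative at \<open>0\<close>, on the unit disc.
\<close>

lemma linear_coefficient_bound:
  fixes E :: "complex set" and m :: "complex \<Rightarrow> nat"
  assumes E: "finite E"
    and bound: "\<And>z. cmod z \<le> 1 \<Longrightarrow> cmod ((\<Prod>\<mu>\<in>E. (1 + z * \<mu>) ^ m \<mu>) - 1) \<le> 1"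
  shows "cmod (\<Sum>\<mu>\<in>E. \<mu> * of_nat (m \<mu>)) \<le> 1"
proof -
  let ?g = "\<lambda>z. (\<Prod>\<mu>\<in>E. (1 + z * \<mu>) ^ m \<mu>) - 1"
  have "((\<lambda>z. \<Prod>\<mu>\<in>E. (1 + z * \<mu>) ^ m \<mu>) has_field_derivative (\<Sum>\<mu>\<in>E. \<mu> * of_nat (m \<mu>))) (at 0)"
    using E
  proof (induction rule: finite_induct)
    case (insert \<mu> E)
    have "((\<lambda>z. (1 + z * \<mu>) ^ m \<mu>) has_field_derivative \<mu> * of_nat (m \<mu>)) (at 0)"
      by (auto intro!: derivative_eq_intros)
    from DERIV_mult[OF this insert.IH] insert.hyps show ?case
      by (simp add: algebra_simps)
  qed simp
  then have "(?g has_field_derivative (\<Sum>\<mu>\<in>E. \<mu> * of_nat (m \<mu>))) (at 0)"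
    by (auto intro!: derivative_eq_intros)
  then have "deriv ?g 0 = (\<Sum>\<mu>\<in>E. \<mu> * of_nat (m \<mu>))"
    by (rule DERIV_imp_deriv)
  moreover have "norm ((deriv ^^ 1) ?g 0) \<le> fact 1 * 1 / 1 ^ 1"
    by (rule Cauchy_inequality) (auto intro!: holomorphic_intros continuous_intros bound)
  ultimately show ?thesis
    by simp
qed

section \<open>The quasinorm topology of an operator ideal\<close>

lemma topspace_quasinorm_topology: "topspace (quasinorm_topology A q X Y) = A X Y"
proof
  show "topspace (quasinorm_topology A q X Y) \<subseteq> A X Y"
    using openin_topspace[of "quasinorm_topology A q X Y"] unfolding openin_quasinorm_topology by simp
  have "openin (quasinorm_topology A q X Y) (A X Y)"
    unfolding openin_quasinorm_topology by (auto intro!: exI[of _ 1])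
  then show "A X Y \<subseteq> topspace (quasinorm_topology A q X Y)"
    by (rule openin_subset)
qed

text \<open>
  A quasinormed operator ideal together with the space \<open>X\<close> whose component \<open>A X X\<close> is studied.
\<close>

locale quasinormed_ideal_on = quasinormed_operator_ideal A q + complex_banach_space X
  for A :: "'a nspace \<Rightarrow> 'a nspace \<Rightarrow> ('a \<Rightarrow> 'a) set"
    and q :: "'a nspace \<Rightarrow> 'a nspace \<Rightarrow> ('a \<Rightarrow> 'a) \<Rightarrow> real"
    and X :: "'a nspace"
begin

abbreviation "qX \<equiv> q X X"
abbreviation "AX \<equiv> A X X"
abbreviation "FX \<equiv> A X X \<inter> finite_rank_ops X"
abbreviation "addX \<equiv> op_add X X"
abbreviation "diffX \<equiv> op_diff X X"
abbreviation "scaleX \<equiv> op_scale X X"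

lemma X_banach: "complex_banach_space X"
  by unfold_locales

lemma A_linear: "u \<in> AX \<Longrightarrow> linear_endo X u"
  using bounded[OF X_banach X_banach] by (auto simp: bounded_ops_def linear_endo_def)

lemma A_mem: "u \<in> AX \<Longrightarrow> y \<in> carrier X \<Longrightarrow> u y \<in> carrier X"
  using linear_endoD(1)[OF A_linear] .

lemma A_eqI:
  assumes "u \<in> AX" "v \<in> AX" "\<And>y. y \<in> carrier X \<Longrightarrow> u y = v y"
  shows "u = v"
  using bounded[OF X_banach X_banach] assms
  by (intro extensionalityI[of _ "carrier X"]) (auto simp: bounded_ops_def)

lemma minus_eq_smult: "y \<in> carrier X \<Longrightarrow> \<ominus>\<^bsub>X\<^esub> y = (- 1 :: complex) \<odot>\<^bsub>X\<^esub> y"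
  using diff_eq_add_smult[of "\<zero>\<^bsub>X\<^esub>" y 1] by (simp add: a_minus_def)

lemma add_A: "u \<in> AX \<Longrightarrow> v \<in> AX \<Longrightarrow> addX u v \<in> AX"
  and scale_A: "u \<in> AX \<Longrightarrow> scaleX c u \<in> AX"
  and zero_A: "op_zero X X \<in> AX"
  by (auto intro: add_mem scale_mem zero_mem X_banach)

lemma diff_eq: "u \<in> AX \<Longrightarrow> v \<in> AX \<Longrightarrow> diffX u v = addX u (scaleX (- 1) v)"
  by (auto simp: op_diff_def op_add_def op_scale_def a_minus_def minus_eq_smult A_mem
      intro!: restrict_ext)

lemma diff_A: "u \<in> AX \<Longrightarrow> v \<in> AX \<Longrightarrow> diffX u v \<in> AX"
  by (simp add: diff_eq add_A scale_A)

lemma F_add: "u \<in> FX \<Longrightarrow> v \<in> FX \<Longrightarrow> addX u v \<in> FX"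
  and F_scale: "u \<in> FX \<Longrightarrow> scaleX c u \<in> FX"
  by (simp_all add: add_A scale_A op_add_finite_rank op_scale_finite_rank)

lemma F_diff: "u \<in> FX \<Longrightarrow> v \<in> FX \<Longrightarrow> diffX u v \<in> FX"
  using F_add[OF _ F_scale[of v "- 1"]] diff_eq by auto

lemma op_trace_diff: "u \<in> FX \<Longrightarrow> v \<in> FX \<Longrightarrow> op_trace X (diffX u v) = op_trace X u - op_trace X v"
  using F_scale[of v "- 1"] by (simp add: diff_eq op_add_finite_rank op_scale_finite_rank)

lemmas op_apply = op_add_def op_diff_def op_scale_def op_zero_def

lemma diff_self: "u \<in> AX \<Longrightarrow> diffX u u = op_zero X X"
  by (intro A_eqI diff_A zero_A) (simp_all add: op_apply A_mem a_minus_def r_neg)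

lemma diff_zero: "u \<in> AX \<Longrightarrow> diffX u (op_zero X X) = u"
  by (intro A_eqI diff_A zero_A) (simp_all add: op_apply A_mem a_minus_def)

lemma diff_swap: "u \<in> AX \<Longrightarrow> v \<in> AX \<Longrightarrow> diffX u v = scaleX (- 1) (diffX v u)"
  by (intro A_eqI diff_A scale_A)
    (simp_all add: op_apply A_mem a_minus_def minus_eq_smult smult_add_right smult_smult a_ac)

lemma diff_triangle: "u \<in> AX \<Longrightarrow> v \<in> AX \<Longrightarrow> w \<in> AX \<Longrightarrow> diffX u w = addX (diffX u v) (diffX v w)"
  by (intro A_eqI diff_A add_A) (simp_all add: op_apply A_mem a_minus_def a_assoc r_neg1)

lemma diff_add_add:
  "u \<in> AX \<Longrightarrow> v \<in> AX \<Longrightarrow> u' \<in> AX \<Longrightarrow> v' \<in> AX \<Longrightarrow>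
    diffX (addX u v) (addX u' v') = addX (diffX u u') (diffX v v')"
  by (intro A_eqI diff_A add_A) (simp_all add: op_apply A_mem a_minus_def minus_add a_ac)

lemma diff_scale_scale:
  "u \<in> AX \<Longrightarrow> v \<in> AX \<Longrightarrow> diffX (scaleX c u) (scaleX c v) = scaleX c (diffX u v)"
  by (intro A_eqI diff_A scale_A)
    (simp_all add: op_apply A_mem a_minus_def minus_eq_smult smult_add_right smult_smult)

lemma add_diff: "u \<in> AX \<Longrightarrow> v \<in> AX \<Longrightarrow> addX v (diffX u v) = u"
  by (intro A_eqI diff_A add_A)
    (simp_all add: op_apply A_mem a_minus_def a_lcomm[of "v _"] r_neg)

lemma qA_nonneg: "u \<in> AX \<Longrightarrow> 0 \<le> qX u"
  by (rule q_nonneg[OF X_banach X_banach])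

lemma q_A_scale: "u \<in> AX \<Longrightarrow> qX (scaleX c u) = cmod c * qX u"
  by (rule q_scale[OF X_banach X_banach])

lemma q_diff_swap: "u \<in> AX \<Longrightarrow> v \<in> AX \<Longrightarrow> qX (diffX u v) = qX (diffX v u)"
  using diff_swap[of u v] q_A_scale[of "diffX v u" "- 1"] by (simp add: diff_A)

lemma q_diff_self: "u \<in> AX \<Longrightarrow> qX (diffX u u) = 0"
  using q_eq_zero_iff[OF X_banach X_banach zero_A] by (simp add: diff_self)

text \<open>
  A constant for the quasi-triangle inequality on \<open>A X X\<close>, chosen to be positive.
\<close>

definition modulus :: real where
  "modulus = (SOME C. C > 0 \<and> (\<forall>u\<in>AX. \<forall>v\<in>AX. qX (addX u v) \<le> C * (qX u + qX v)))"

lemma modulus_pos: "modulus > 0"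
  and q_add_le: "u \<in> AX \<Longrightarrow> v \<in> AX \<Longrightarrow> qX (addX u v) \<le> modulus * (qX u + qX v)"
proof -
  obtain C0 where C0: "\<forall>u\<in>AX. \<forall>v\<in>AX. qX (addX u v) \<le> C0 * (qX u + qX v)"
    using q_quasi_triangle[OF X_banach X_banach] by blast
  have "qX (addX u v) \<le> max C0 1 * (qX u + qX v)" if "u \<in> AX" "v \<in> AX" for u v
  proof -
    have "qX (addX u v) \<le> C0 * (qX u + qX v)"
      using C0 that by blast
    also have "\<dots> \<le> max C0 1 * (qX u + qX v)"
      using qA_nonneg[OF that(1)] qA_nonneg[OF that(2)] by (intro mult_right_mono) auto
    finally show ?thesis .
  qed
  then have "\<exists>C>0. \<forall>u\<in>AX. \<forall>v\<in>AX. qX (addX u v) \<le> C * (qX u + qX v)"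
    by (intro exI[of _ "max C0 1"]) auto
  then have "modulus > 0 \<and> (\<forall>u\<in>AX. \<forall>v\<in>AX. qX (addX u v) \<le> modulus * (qX u + qX v))"
    unfolding modulus_def by (rule someI_ex)
  then show "modulus > 0" and "u \<in> AX \<Longrightarrow> v \<in> AX \<Longrightarrow> qX (addX u v) \<le> modulus * (qX u + qX v)"
    by auto
qed

lemma q_diff_le:
  "u \<in> AX \<Longrightarrow> v \<in> AX \<Longrightarrow> w \<in> AX \<Longrightarrow> qX (diffX u w) \<le> modulus * (qX (diffX u v) + qX (diffX v w))"
  using q_add_le[of "diffX u v" "diffX v w"] diff_triangle[of u v w] by (simp add: diff_A)

text \<open>
  Balls need not be open in the quasinorm topology. The quasi-triangle inequality shows that they
  are neighbourhoods of their centres, so a point of the closure of \<open>S\<close> can be approximated by points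
  of \<open>S\<close> in the quasinorm.
\<close>

lemma closure_of_approx:
  assumes u: "u \<in> quasinorm_topology A q X X closure_of S" and "e > 0"
  shows "\<exists>v\<in>S. v \<in> AX \<and> qX (diffX v u) < e"
proof -
  \<comment> \<open>\<open>U\<close> is the interior of the ball with centre \<open>u\<close> and radius \<open>e\<close>.\<close>
  define U where "U = {v \<in> AX. \<exists>d>0. \<forall>w\<in>AX. qX (diffX w v) < d \<longrightarrow> qX (diffX w u) < e}"
  have uA: "u \<in> AX"
    using u by (simp add: in_closure_of topspace_quasinorm_topology)
  have "openin (quasinorm_topology A q X X) U"
    unfolding openin_quasinorm_topology
  proof (intro conjI ballI)
    fix v assume "v \<in> U"
    then obtain d where v: "v \<in> AX" and d: "d > 0" "\<forall>w\<in>AX. qX (diffX w v) < d \<longrightarrow> qX (diffX w u) < e"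
      by (auto simp: U_def)
    define r where "r = d / (2 * modulus)"
    have r: "r > 0"
      using d modulus_pos by (simp add: r_def)
    have "w \<in> U" if w: "w \<in> AX" "qX (diffX w v) < r" for w
    proof -
      have "qX (diffX w' u) < e" if w': "w' \<in> AX" "qX (diffX w' w) < r" for w'
      proof -
        have "qX (diffX w' v) \<le> modulus * (qX (diffX w' w) + qX (diffX w v))"
          using w w' v by (intro q_diff_le)
        also have "\<dots> < modulus * (r + r)"
          using w w' modulus_pos by (intro mult_strict_left_mono add_strict_mono)
        also have "\<dots> = d"
          using modulus_pos by (simp add: r_def)
        finally show ?thesis
          using d w' by blast
      qed
      then show ?thesis
        using w r by (auto simp: U_def)
    qed
    then show "\<exists>r>0. \<forall>w\<in>AX. qX (diffX w v) < r \<longrightarrow> w \<in> U"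
      using r by blast
  qed (auto simp: U_def)
  moreover have "u \<in> U"
    using uA \<open>e > 0\<close> by (auto simp: U_def)
  ultimately obtain v where "v \<in> S" "v \<in> U"
    using u by (auto simp: in_closure_of)
  then show ?thesis
    using q_diff_self by (fastforce simp: U_def)
qed

lemma continuous_map_quasinormD:
  fixes \<phi> :: "('a \<Rightarrow> 'a) \<Rightarrow> 'b :: metric_space"
  assumes "continuous_map (quasinorm_topology A q X X) euclidean \<phi>" "u \<in> AX" "e > 0"
  obtains d where "d > 0" "\<And>v. v \<in> AX \<Longrightarrow> qX (diffX v u) < d \<Longrightarrow> dist (\<phi> u) (\<phi> v) < e"
proof -
  have "openin (quasinorm_topology A q X X) {v \<in> AX. \<phi> v \<in> ball (\<phi> u) e}"
    using openin_continuous_map_preimage[OF assms(1), of "ball (\<phi> u) e"]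
    by (simp add: topspace_quasinorm_topology)
  moreover have "u \<in> {v \<in> AX. \<phi> v \<in> ball (\<phi> u) e}"
    using assms by simp
  ultimately have "\<exists>d>0. \<forall>v\<in>AX. qX (diffX v u) < d \<longrightarrow> v \<in> {v \<in> AX. \<phi> v \<in> ball (\<phi> u) e}"
    unfolding openin_quasinorm_topology by blast
  then show thesis
    using that by auto
qed

lemma continuous_map_quasinormI:
  fixes \<phi> :: "('a \<Rightarrow> 'a) \<Rightarrow> 'b :: metric_space"
  assumes "\<And>u e. u \<in> AX \<Longrightarrow> e > 0 \<Longrightarrow> \<exists>d>0. \<forall>v\<in>AX. qX (diffX v u) < d \<longrightarrow> dist (\<phi> v) (\<phi> u) < e"
  shows "continuous_map (quasinorm_topology A q X X) euclidean \<phi>"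
  unfolding continuous_map topspace_quasinorm_topology
proof (intro conjI allI impI)
  fix U :: "'b set" assume "openin euclidean U"
  then have U: "open U"
    by simp
  show "openin (quasinorm_topology A q X X) {u \<in> AX. \<phi> u \<in> U}"
    unfolding openin_quasinorm_topology
  proof (intro conjI ballI)
    fix u assume "u \<in> {u \<in> AX. \<phi> u \<in> U}"
    then obtain e where u: "u \<in> AX" and e: "e > 0" "\<And>y. dist y (\<phi> u) < e \<Longrightarrow> y \<in> U"
      using U by (auto simp: open_dist)
    obtain d where "d > 0" "\<forall>v\<in>AX. qX (diffX v u) < d \<longrightarrow> dist (\<phi> v) (\<phi> u) < e"
      using assms[OF u e(1)] by blast
    then show "\<exists>d>0. \<forall>v\<in>AX. qX (diffX v u) < d \<longrightarrow> v \<in> {u \<in> AX. \<phi> u \<in> U}"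
      using e by auto
  qed auto
qed auto

section \<open>Boundedness of the trace\<close>

lemma op_trace_bounded:
  assumes "extends_continuously A q X (det_one_plus X) D"
  obtains b where "b \<ge> 0" "\<forall>u\<in>FX. cmod (op_trace X u) \<le> b * qX u"
proof -
  have cont: "continuous_map (quasinorm_topology A q X X) euclidean D"
    and D: "\<And>u. u \<in> FX \<Longrightarrow> D u = det_one_plus X u"
    using assms by (auto simp: extends_continuously_def)
  have "scaleX 0 (op_zero X X) = op_zero X X"
    by (intro A_eqI scale_A zero_A) (simp_all add: op_apply)
  then have "det_one_plus X (op_zero X X) = 1"
    using det_one_plus_scale[OF A_linear[OF zero_A], of 0] by simp
  then have D0: "D (op_zero X X) = 1"
    using D[of "op_zero X X"] by (simp add: zero_A op_zero_finite_rank)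
  obtain d where d: "d > 0"
    "\<And>v. v \<in> AX \<Longrightarrow> qX (diffX v (op_zero X X)) < d \<Longrightarrow> dist (D (op_zero X X)) (D v) < 1"
    using continuous_map_quasinormD[OF cont zero_A, of 1] by auto
  have small: "cmod (op_trace X u) \<le> 1" if u: "u \<in> FX" "qX u < d" for u
  proof -
    have "cmod ((\<Prod>\<mu>\<in>eigenvalues X u. (1 + z * \<mu>) ^ alg_mult X u \<mu>) - 1) \<le> 1"
      if z: "cmod z \<le> 1" for z
    proof -
      have zu: "scaleX z u \<in> FX"
        using u(1) by (rule F_scale)
      have "qX (scaleX z u) \<le> 1 * qX u"
        using u z qA_nonneg[of u] by (simp add: q_A_scale mult_right_le_one_le mult_left_le_one_le)
      then have "dist (D (op_zero X X)) (D (scaleX z u)) < 1"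
        using zu u(2) by (intro d) (auto simp: diff_zero)
      then have "cmod (det_one_plus X (scaleX z u) - 1) < 1"
        using D[OF zu] D0 by (simp add: dist_norm norm_minus_commute)
      then show ?thesis
        using det_one_plus_scale[of u z] u by (simp add: A_linear)
    qed
    then show ?thesis
      using u op_trace_eq_sum_eigenvalues[of u]
      by (auto intro!: linear_coefficient_bound)
  qed
  show thesis
  proof (rule that[of "2 / d"]; (intro ballI)?)
    fix u assume u: "u \<in> FX"
    show "cmod (op_trace X u) \<le> 2 / d * qX u"
    proof (cases "qX u = 0")
      case True
      then have "u = op_zero X X"
        using u q_eq_zero_iff[OF X_banach X_banach] by blast
      then show ?thesis
        using True by (simp add: op_trace_zero)
    next
      case False
      then have qu: "qX u > 0"
        using qA_nonneg[of u] u by auto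
      \<comment> \<open>Scaling by \<open>c\<close> brings \<open>u\<close> to quasinorm \<open>d / 2\<close>.\<close>
      define c where "c = d / (2 * qX u)"
      have c: "c > 0"
        using qu d(1) by (simp add: c_def)
      have "qX (scaleX (of_real c) u) = c * qX u"
        using u c by (simp add: q_A_scale)
      also have "\<dots> = d / 2"
        using qu by (simp add: c_def)
      finally have "qX (scaleX (of_real c) u) = d / 2" .
      then have "cmod (op_trace X (scaleX (of_real c) u)) \<le> 1"
        using d(1) F_scale[OF u] by (intro small) auto
      then have "c * cmod (op_trace X u) \<le> 1"
        using u c by (simp add: op_scale_finite_rank norm_mult)
      then show ?thesis
        using qu d(1) by (simp add: c_def field_simps)
    qed
  qed (use d(1) in simp)
qed

section \<open>Extension of the trace by continuity\<close>

text \<open>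
  \<open>v\<close> is a sequence of finite rank operators in \<open>A X X\<close> that converges to \<open>u\<close> in the quasinorm.
\<close>

definition approx :: "(nat \<Rightarrow> 'a \<Rightarrow> 'a) \<Rightarrow> ('a \<Rightarrow> 'a) \<Rightarrow> bool" where
  "approx v u \<longleftrightarrow> (\<forall>n. v n \<in> FX) \<and> (\<lambda>n. qX (diffX (v n) u)) \<longlonglongrightarrow> 0"

lemma approx_finite_rank: "approx v u \<Longrightarrow> v n \<in> FX"
  by (simp add: approx_def)

lemma approx_const: "u \<in> FX \<Longrightarrow> approx (\<lambda>_. u) u"
  by (simp add: approx_def q_diff_self)

lemma approx_add:
  assumes "u \<in> AX" "u' \<in> AX" "approx v u" "approx v' u'"
  shows "approx (\<lambda>n. addX (v n) (v' n)) (addX u u')"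
  unfolding approx_def
proof
  have v: "v n \<in> FX" "v' n \<in> FX" for n
    using assms by (auto simp: approx_def)
  show "\<forall>n. addX (v n) (v' n) \<in> FX"
    using F_add[OF v] by blast
  have "(\<lambda>n. modulus * (qX (diffX (v n) u) + qX (diffX (v' n) u'))) \<longlonglongrightarrow> modulus * (0 + 0)"
    using assms by (intro tendsto_intros) (auto simp: approx_def)
  then have lim: "(\<lambda>n. modulus * (qX (diffX (v n) u) + qX (diffX (v' n) u'))) \<longlonglongrightarrow> 0"
    by simp
  have le: "qX (diffX (addX (v n) (v' n)) (addX u u')) \<le>
      modulus * (qX (diffX (v n) u) + qX (diffX (v' n) u'))" for n
    using v assms q_add_le[of "diffX (v n) u" "diffX (v' n) u'"] by (simp add: diff_add_add diff_A)
  have ge: "0 \<le> qX (diffX (addX (v n) (v' n)) (addX u u'))" for n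
    using v assms by (intro qA_nonneg diff_A add_A) auto
  show "(\<lambda>n. qX (diffX (addX (v n) (v' n)) (addX u u'))) \<longlonglongrightarrow> 0"
    by (rule tendsto_sandwich[OF _ _ tendsto_const lim]) (simp_all add: ge le)
qed

lemma approx_scale:
  assumes "u \<in> AX" "approx v u"
  shows "approx (\<lambda>n. scaleX c (v n)) (scaleX c u)"
proof -
  have v: "v n \<in> FX" for n
    using assms by (auto simp: approx_def)
  have "(\<lambda>n. cmod c * qX (diffX (v n) u)) \<longlonglongrightarrow> cmod c * 0"
    using assms by (intro tendsto_intros) (auto simp: approx_def)
  then show ?thesis
    using v assms F_scale by (simp add: approx_def diff_scale_scale q_A_scale diff_A)
qed

lemma approx_exists:
  assumes "u \<in> quasinorm_topology A q X X closure_of FX"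
  shows "\<exists>v. approx v u"
proof -
  have "\<exists>v. v \<in> FX \<and> qX (diffX v u) < inverse (real (Suc n))" for n
    using closure_of_approx[OF assms, of "inverse (real (Suc n))"] by auto
  then obtain v where v: "\<And>n. v n \<in> FX" "\<And>n. qX (diffX (v n) u) < inverse (real (Suc n))"
    by metis
  have u: "u \<in> AX"
    using assms by (simp add: in_closure_of topspace_quasinorm_topology)
  have "0 \<le> qX (diffX (v n) u)" "qX (diffX (v n) u) \<le> inverse (real (Suc n))" for n
    using u v[of n] by (auto intro: qA_nonneg diff_A less_imp_le)
  then have "(\<lambda>n. qX (diffX (v n) u)) \<longlonglongrightarrow> 0"
    by (intro tendsto_sandwich[OF _ _ tendsto_const LIMSEQ_inverse_real_of_nat] always_eventually allI)
  then show ?thesis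
    using v by (auto simp: approx_def)
qed

text \<open>
  From here on the trace is assumed to be bounded, with constant \<open>b\<close>, on a dense subspace.
\<close>

context
  fixes b :: real
  assumes dense: "quasinorm_topology A q X X closure_of FX = AX"
    and b: "b \<ge> 0" "\<forall>u\<in>FX. cmod (op_trace X u) \<le> b * qX u"
begin

lemma op_trace_dist_le:
  assumes "v \<in> FX" "w \<in> FX" "u \<in> AX"
  shows "cmod (op_trace X v - op_trace X w) \<le> b * (modulus * (qX (diffX v u) + qX (diffX w u)))"
proof -
  have "cmod (op_trace X v - op_trace X w) \<le> b * qX (diffX v w)"
    using bspec[OF b(2) F_diff[OF assms(1,2)]] op_trace_diff[OF assms(1,2)] by simp
  also have "qX (diffX v w) \<le> modulus * (qX (diffX v u) + qX (diffX w u))"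
    using q_diff_le[of v u w] q_diff_swap[of u w] assms by simp
  finally show ?thesis
    using b(1) by (simp add: mult_left_mono)
qed

lemma op_trace_converges:
  assumes u: "u \<in> AX"
  shows "\<exists>t. \<forall>v. approx v u \<longrightarrow> (\<lambda>n. op_trace X (v n)) \<longlonglongrightarrow> t"
proof -
  obtain w where w: "approx w u"
    using approx_exists[of u] dense u by auto
  have "Cauchy (\<lambda>n. op_trace X (w n))"
  proof (rule CauchyI)
    fix e :: real assume "e > 0"
    define K where "K = b * modulus + 1"
    define r where "r = e / (2 * K)"
    have b_modulus: "b * modulus \<ge> 0"
      using b(1) modulus_pos by simp
    then have K: "K > 0" "b * modulus < K"
      by (simp_all add: K_def)
    then have r: "r > 0"
      using \<open>e > 0\<close> by (simp add: r_def)
    then obtain N where N: "\<And>n. n \<ge> N \<Longrightarrow> qX (diffX (w n) u) < r"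
      using w order_tendstoD(2)[of "\<lambda>n. qX (diffX (w n) u)" 0 sequentially r]
      by (auto simp: approx_def eventually_sequentially)
    have "cmod (op_trace X (w m) - op_trace X (w n)) < e" if "m \<ge> N" "n \<ge> N" for m n
    proof -
      have "cmod (op_trace X (w m) - op_trace X (w n)) \<le> b * modulus * (qX (diffX (w m) u) + qX (diffX (w n) u))"
        using op_trace_dist_le[of "w m" "w n" u] w u by (simp add: approx_def mult.assoc)
      also have "\<dots> \<le> b * modulus * (2 * r)"
        using N[OF that(1)] N[OF that(2)] b_modulus by (intro mult_left_mono) auto
      also have "\<dots> < K * (2 * r)"
        using r K by simp
      also have "\<dots> = e"
        using K by (simp add: r_def)
      finally show ?thesis .
    qed
    then show "\<exists>N. \<forall>m\<ge>N. \<forall>n\<ge>N. norm (op_trace X (w m) - op_trace X (w n)) < e"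
      by blast
  qed
  then obtain t where t: "(\<lambda>n. op_trace X (w n)) \<longlonglongrightarrow> t"
    using Cauchy_convergent convergent_def by blast
  have "(\<lambda>n. op_trace X (v n)) \<longlonglongrightarrow> t" if v: "approx v u" for v
  proof -
    have "(\<lambda>n. b * (modulus * (qX (diffX (v n) u) + qX (diffX (w n) u)))) \<longlonglongrightarrow> b * (modulus * (0 + 0))"
      using v w by (intro tendsto_intros) (auto simp: approx_def)
    then have "(\<lambda>n. b * (modulus * (qX (diffX (v n) u) + qX (diffX (w n) u)))) \<longlonglongrightarrow> 0"
      by simp
    moreover have "cmod (op_trace X (v n) - op_trace X (w n)) \<le>
        b * (modulus * (qX (diffX (v n) u) + qX (diffX (w n) u)))" for n
      using v w u by (intro op_trace_dist_le) (auto simp: approx_def)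
    ultimately have "(\<lambda>n. op_trace X (v n) - op_trace X (w n)) \<longlonglongrightarrow> 0"
      by (rule Lim_null_comparison[OF always_eventually[OF allI], rotated])
    from tendsto_add[OF this t] show ?thesis
      by simp
  qed
  then show ?thesis
    by blast
qed

text \<open>
  The extension of the trace to \<open>A X X\<close>: the common limit of the traces along all approximating
  sequences.
\<close>

definition trace_ext :: "('a \<Rightarrow> 'a) \<Rightarrow> complex" where
  "trace_ext u = (SOME t. \<forall>v. approx v u \<longrightarrow> (\<lambda>n. op_trace X (v n)) \<longlonglongrightarrow> t)"

lemma tendsto_trace_ext: "u \<in> AX \<Longrightarrow> approx v u \<Longrightarrow> (\<lambda>n. op_trace X (v n)) \<longlonglongrightarrow> trace_ext u"
  using someI_ex[OF op_trace_converges] unfolding trace_ext_def by blast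

lemma obtain_approx:
  assumes "u \<in> AX"
  obtains v where "approx v u"
  using approx_exists[of u] dense assms by auto

lemma trace_ext_finite_rank: "u \<in> FX \<Longrightarrow> trace_ext u = op_trace X u"
  using LIMSEQ_unique[OF tendsto_trace_ext[OF _ approx_const[of u]] tendsto_const] by blast

lemma trace_ext_add:
  assumes "u \<in> AX" "v \<in> AX"
  shows "trace_ext (addX u v) = trace_ext u + trace_ext v"
proof -
  obtain u' where u': "approx u' u"
    using assms(1) by (rule obtain_approx)
  obtain v' where v': "approx v' v"
    using assms(2) by (rule obtain_approx)
  have "(\<lambda>n. op_trace X (addX (u' n) (v' n))) \<longlonglongrightarrow> trace_ext (addX u v)"
    using assms u' v' by (intro tendsto_trace_ext add_A approx_add)
  moreover have "(\<lambda>n. op_trace X (addX (u' n) (v' n))) \<longlonglongrightarrow> trace_ext u + trace_ext v"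
    using tendsto_add[OF tendsto_trace_ext[OF assms(1) u'] tendsto_trace_ext[OF assms(2) v']]
      approx_finite_rank[OF u'] approx_finite_rank[OF v']
    by (simp add: op_add_finite_rank)
  ultimately show ?thesis
    by (rule LIMSEQ_unique)
qed

lemma trace_ext_scale:
  assumes "u \<in> AX"
  shows "trace_ext (scaleX c u) = c * trace_ext u"
proof -
  obtain u' where u': "approx u' u"
    using assms by (rule obtain_approx)
  have "(\<lambda>n. op_trace X (scaleX c (u' n))) \<longlonglongrightarrow> trace_ext (scaleX c u)"
    using assms u' by (intro tendsto_trace_ext scale_A approx_scale)
  moreover have "(\<lambda>n. op_trace X (scaleX c (u' n))) \<longlonglongrightarrow> c * trace_ext u"
    using tendsto_mult_left[OF tendsto_trace_ext[OF assms u']] approx_finite_rank[OF u']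
    by (simp add: op_scale_finite_rank)
  ultimately show ?thesis
    by (rule LIMSEQ_unique)
qed

lemma trace_ext_bounded:
  assumes u: "u \<in> AX"
  shows "cmod (trace_ext u) \<le> b * (modulus * qX u)"
proof -
  obtain v where v: "approx v u"
    using u by (rule obtain_approx)
  have le: "cmod (op_trace X (v n)) \<le> b * (modulus * (qX (diffX (v n) u) + qX u))" for n
  proof -
    have "cmod (op_trace X (v n)) \<le> b * qX (v n)"
      using b(2) approx_finite_rank[OF v] by blast
    also have "qX (v n) \<le> modulus * (qX (diffX (v n) u) + qX u)"
      using q_add_le[of u "diffX (v n) u"] approx_finite_rank[OF v, of n] u by (simp add: add_diff diff_A add.commute)
    finally show ?thesis
      using b(1) by (simp add: mult_left_mono)
  qed
  have lim: "(\<lambda>n. b * (modulus * (qX (diffX (v n) u) + qX u))) \<longlonglongrightarrow> b * (modulus * (0 + qX u))"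
    using v by (intro tendsto_intros) (simp add: approx_def)
  have "cmod (trace_ext u) \<le> b * (modulus * (0 + qX u))"
    by (rule LIMSEQ_le[OF tendsto_norm[OF tendsto_trace_ext[OF u v]] lim]) (use le in blast)
  then show ?thesis
    by simp
qed

lemma trace_ext_diff: "u \<in> AX \<Longrightarrow> v \<in> AX \<Longrightarrow> trace_ext (diffX u v) = trace_ext u - trace_ext v"
  using trace_ext_add[of v "diffX u v"] by (simp add: diff_A add_diff)

lemma trace_ext_extends: "extends_continuously A q X (op_trace X) trace_ext"
  unfolding extends_continuously_def
proof (intro conjI ballI trace_ext_finite_rank continuous_map_quasinormI)
  fix u :: "'a \<Rightarrow> 'a" and e :: real
  assume u: "u \<in> AX" and e: "e > 0"
  have b_modulus: "b * modulus \<ge> 0"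
    using b(1) modulus_pos by simp
  have "dist (trace_ext v) (trace_ext u) < e" if v: "v \<in> AX" "qX (diffX v u) < e / (b * modulus + 1)" for v
  proof -
    have "dist (trace_ext v) (trace_ext u) \<le> b * modulus * qX (diffX v u)"
      using trace_ext_bounded[of "diffX v u"] u v by (simp add: diff_A trace_ext_diff dist_norm mult.assoc)
    also have "\<dots> \<le> (b * modulus + 1) * qX (diffX v u)"
      using qA_nonneg[of "diffX v u"] u v by (intro mult_right_mono) (auto simp: diff_A)
    also have "\<dots> < e"
      using v(2) b_modulus by (simp add: pos_less_divide_eq mult.commute)
    finally show ?thesis .
  qed
  moreover have "e / (b * modulus + 1) > 0"
    using e b_modulus by simp
  ultimately show "\<exists>d>0. \<forall>v\<in>AX. qX (diffX v u) < d \<longrightarrow> dist (trace_ext v) (trace_ext u) < e"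
    by blast
qed

end

lemma extends_continuously_unique:
  assumes "quasinorm_topology A q X X closure_of FX = AX"
    and "extends_continuously A q X \<phi> \<sigma>" "extends_continuously A q X \<phi> \<rho>" "u \<in> AX"
  shows "\<sigma> u = \<rho> u"
proof -
  have u: "u \<in> quasinorm_topology A q X X closure_of FX"
    using assms(1,4) by simp
  have cont: "continuous_map (quasinorm_topology A q X X) euclidean \<sigma>"
    "continuous_map (quasinorm_topology A q X X) euclidean \<rho>"
    using assms(2,3) unfolding extends_continuously_def by blast+
  have "\<sigma> v = \<rho> v" if "v \<in> FX" for v
    using assms(2,3) that unfolding extends_continuously_def by simp
  then show ?thesis
    using forall_in_closure_of_eq[OF u _ cont] by simp
qed

end

theorem mainTheorem5:
  fixes A :: "'a nspace \<Rightarrow> 'a nspace \<Rightarrow> ('a \<Rightarrow> 'a) set"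
    and q :: "'a nspace \<Rightarrow> 'a nspace \<Rightarrow> ('a \<Rightarrow> 'a) \<Rightarrow> real"
    and X :: "'a nspace"
  assumes ideal: "quasinormed_operator_ideal A q"
    and banach: "complex_banach_space X"
    and dense: "quasinorm_topology A q X X closure_of (A X X \<inter> finite_rank_ops X) = A X X"
    and det_ext: "\<exists>D. extends_continuously A q X (det_one_plus X) D"
  shows "(\<exists>b. \<forall>u \<in> A X X \<inter> finite_rank_ops X. cmod (op_trace X u) \<le> b * q X X u) \<and>
    (\<exists>\<tau>. extends_continuously A q X (op_trace X) \<tau> \<and>
      (\<forall>u\<in>A X X. \<forall>v\<in>A X X. \<tau> (op_add X X u v) = \<tau> u + \<tau> v) \<and>
      (\<forall>c. \<forall>u\<in>A X X. \<tau> (op_scale X X c u) = c * \<tau> u) \<and>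
      (\<forall>\<sigma>. extends_continuously A q X (op_trace X) \<sigma> \<longrightarrow> (\<forall>u\<in>A X X. \<sigma> u = \<tau> u)))"
proof -
  interpret quasinormed_ideal_on A q X
    using ideal banach by (simp add: quasinormed_ideal_on_def)
  obtain D where D: "extends_continuously A q X (det_one_plus X) D"
    using det_ext by blast
  obtain b where b: "b \<ge> 0" "\<forall>u\<in>FX. cmod (op_trace X u) \<le> b * qX u"
    using op_trace_bounded[OF D] by blast
  note ext = trace_ext_extends[OF dense b] trace_ext_add[OF dense b] trace_ext_scale[OF dense b]
  show ?thesis
  proof (intro conjI exI[of _ b] exI[of _ trace_ext] ballI allI impI)
    fix \<sigma> u
    assume "extends_continuously A q X (op_trace X) \<sigma>" "u \<in> A X X"
    then show "\<sigma> u = trace_ext u"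
      using extends_continuously_unique[OF dense _ ext(1)] by blast
  qed (use b(2) ext in blast)+
qed

end
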